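(* Let $\{\omega^{s,t}\}_{s,t\in[0,1]}$ be doubling weights on $\mathbb{T}\otimes\mathbb{T}$ with doubling constants at most $C_{\rm dbl}$, and suppose $(s,t,x,y)\mapsto\omega^{s,t}(x,y)$ is measurable. (1) Fix $1\le p\le\infty$; if $\omega^{s,t}\in A_p^d(\mathbb{T}\otimes\mathbb{T})$ with $A_p^d(\omega^{s,t})\le V_{p,d}$ for all $s,t$, then $\omega(x,y)=\int_0^1\!\int_0^1\omega^{s,t}(x+s,y+t)\,ds\,dt$ belongs to $A_p(\mathbb{T}\otimes\mathbb{T})$ with constant depending only on $p,V_{p,d},C_{\rm dbl}$. (2) Fix $1<p\le\infty$; if $\omega^{s,t}\in RH_p^d(\mathbb{T}\otimes\mathbb{T})$ with $RH_p^d(\omega^{s,t})\le V_{p,d}$ for all $s,t$, then $\omega\in RH_p(\mathbb{T}\otimes\mathbb{T})$ with $RH_p(\omega)$ depending only on $p,V_{p,d},C_{\rm dbl}$.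
   Context: $\mathbb{T}$ is the circle $[0,1]$ with endpoints identified, additions mod 1; $\mathbb{T}\otimes\mathbb{T}=\mathbb{T}^2$. Rectangles $R=Q_1\times Q_2$ ($Q_i$ intervals), dyadic rectangles $I\times J$ ($I,J\in\mathcal{D}=\{[0,1]\}\cup\{[j2^{-k},(j+1)2^{-k})\}$). $\omega$ is doubling with constant $C$ if $\int_{\widetilde Q_1\times\widetilde Q_2}\omega\le C\int_{Q_1\times Q_2}\omega$ for all rectangles, $\widetilde Q$ being the interval with the same midpoint and twice the length. $-\!\!\!\!\!\!\int_E f=\frac1{|E|}\int_Ef$. Product $A_p$, $RH_p$ constants are the one-variable definitions with intervals replaced by rectangles: $A_p(\omega)=\sup_R(-\!\!\!\!\!\!\int_R\omega)(-\!\!\!\!\!\!\int_R\omega^{-1/(p-1)})^{p-1}$ ($1<p<\infty$), $A_1(\omega)=\sup_R(-\!\!\!\!\!\!\int_R\omega)/\operatorname{ess\,inf}_R\omega$, $A_\infty(\omega)=\sup_R(-\!\!\!\!\!\!\int_R\omega)\exp(-\!\!\!\!\!\!\int_R\log(1/\omega))$, $RH_p(\omega)=\sup_R(-\!\!\!\!\!\!\int_R\omega^p)^{1/p}(-\!\!\!\!\!\!\int_R\omega)^{-1}$, $RH_\infty(\omega)=\sup_R(\operatorname{ess\,sup}_R\omega)(-\!\!\!\!\!\!\int_R\omega)^{-1}$. Dyadic versions take suprema over dyadic rectangles; $RH_p^d$ additionally requires dyadic doubling ($\int_{\widetilde I\times\widetilde J}\omega\le C\int_{I\times J}\omega$, $\widetilde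 I$ the dyadic interval of length $2|I|$ containing $I$), with $RH_p^d(\omega)$ the max of the dyadic supremum and this doubling constant.
   Formalization: The map (s,t,x,y)↦ω^{s,t}(x,y) is also assumed integrable over [0,1]^4, so that ω is a weight; without this the claim fails (constant weights ω^{s,t}=1/s satisfy every hypothesis but give ω=∞). *)

theory Defs
  imports "HOL-Analysis.Analysis"
begin

text \<open>Functions on the torus T x T are represented by functions of two real
variables whose values on [0,1) x [0,1) matter; per f is the 1-periodic
extension to the plane (additions mod 1).\<close>

definition per :: "(real \<Rightarrow> real \<Rightarrow> real) \<Rightarrow> real \<times> real \<Rightarrow> real" where
  "per f z = f (frac (fst z)) (frac (snd z))"

definition avg :: "(real \<times> real) set \<Rightarrow> (real \<times> real \<Rightarrow> real) \<Rightarrow> real" where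
  "avg R g = set_lebesgue_integral lebesgue R g / measure lebesgue R"

text \<open>Rectangles of the torus: products of arcs, represented as real intervals of
length in (0,1] (the periodic extension is integrated over them).\<close>

definition torus_rects :: "(real \<times> real) set set" where
  "torus_rects = {{a..a+l} \<times> {b..b+m} | a b l m. 0 < l \<and> l \<le> 1 \<and> 0 < m \<and> m \<le> 1}"

definition dyad :: "nat \<Rightarrow> nat \<Rightarrow> real set" where
  "dyad k j = {real j / 2^k ..< (real j + 1) / 2^k}"

definition dyadic_rects :: "(real \<times> real) set set" where
  "dyadic_rects = {dyad k1 j1 \<times> dyad k2 j2 | k1 j1 k2 j2. j1 < 2^k1 \<and> j2 < 2^k2}"

text \<open>Dyadic parent (index form); the parent of [0,1) is taken to be itself.\<close>

definition dpar :: "nat \<times> nat \<Rightarrow> nat \<times> nat" where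
  "dpar kj = (if fst kj = 0 then (0, 0) else (fst kj - 1, snd kj div 2))"

definition weight :: "(real \<Rightarrow> real \<Rightarrow> real) \<Rightarrow> bool" where
  "weight f \<longleftrightarrow> (\<lambda>z. f (fst z) (snd z)) \<in> borel_measurable lebesgue
     \<and> set_integrable lebesgue ({0..1} \<times> {0..1}) (per f)
     \<and> (AE z in lebesgue. z \<in> {0..1} \<times> {0..1} \<longrightarrow> 0 < per f z)"

definition doubling :: "real \<Rightarrow> (real \<times> real \<Rightarrow> real) \<Rightarrow> bool" where
  "doubling C g \<longleftrightarrow> (\<forall>a b l m. 0 < l \<and> l \<le> 1 \<and> 0 < m \<and> m \<le> 1 \<longrightarrow>
     set_lebesgue_integral lebesgue ({a - l/2 .. a + 3*l/2} \<times> {b - m/2 .. b + 3*m/2}) g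
       \<le> C * set_lebesgue_integral lebesgue ({a..a+l} \<times> {b..b+m}) g)"

definition dyadic_doubling :: "real \<Rightarrow> (real \<times> real \<Rightarrow> real) \<Rightarrow> bool" where
  "dyadic_doubling C g \<longleftrightarrow> (\<forall>k1 j1 k2 j2. j1 < 2^k1 \<and> j2 < 2^k2 \<longrightarrow>
     set_lebesgue_integral lebesgue
        (dyad (fst (dpar (k1,j1))) (snd (dpar (k1,j1))) \<times> dyad (fst (dpar (k2,j2))) (snd (dpar (k2,j2)))) g
       \<le> C * set_lebesgue_integral lebesgue (dyad k1 j1 \<times> dyad k2 j2) g)"

definition Ap_cond :: "ereal \<Rightarrow> real \<Rightarrow> (real \<times> real) set set \<Rightarrow> (real \<times> real \<Rightarrow> real) \<Rightarrow> bool" where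
  "Ap_cond p K Rs g \<longleftrightarrow> (\<forall>R\<in>Rs. set_integrable lebesgue R g \<and>
     (if p = \<infinity> then
        set_integrable lebesgue R (\<lambda>z. ln (1 / g z)) \<and>
        avg R g * exp (avg R (\<lambda>z. ln (1 / g z))) \<le> K
      else if p = 1 then
        (AE z in lebesgue. z \<in> R \<longrightarrow> avg R g \<le> K * g z)
      else
        set_integrable lebesgue R (\<lambda>z. g z powr (-1 / (real_of_ereal p - 1))) \<and>
        avg R g * (avg R (\<lambda>z. g z powr (-1 / (real_of_ereal p - 1)))) powr (real_of_ereal p - 1) \<le> K))"

definition RH_cond :: "ereal \<Rightarrow> real \<Rightarrow> (real \<times> real) set set \<Rightarrow> (real \<times> real \<Rightarrow> real) \<Rightarrow> bool" where
  "RH_cond p K Rs g \<longleftrightarrow> (\<forall>R\<in>Rs. set_integrable lebesgue R g \<and>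
     (if p = \<infinity> then
        (AE z in lebesgue. z \<in> R \<longrightarrow> g z \<le> K * avg R g)
      else
        set_integrable lebesgue R (\<lambda>z. g z powr real_of_ereal p) \<and>
        (avg R (\<lambda>z. g z powr real_of_ereal p)) powr (1 / real_of_ereal p) \<le> K * avg R g))"

definition RHd_cond :: "ereal \<Rightarrow> real \<Rightarrow> (real \<times> real \<Rightarrow> real) \<Rightarrow> bool" where
  "RHd_cond p K g \<longleftrightarrow> RH_cond p K dyadic_rects g \<and> dyadic_doubling K g"

text \<open>The family (s,t,x,y) \<mapsto> W s t x y: jointly measurable, and (implicit in the paper,
so that the average is a weight) integrable over [0,1]^4.\<close>

definition joint_ok :: "(real \<Rightarrow> real \<Rightarrow> real \<Rightarrow> real \<Rightarrow> real) \<Rightarrow> bool" where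
  "joint_ok W \<longleftrightarrow>
     (\<lambda>u. W (fst (fst u)) (snd (fst u)) (fst (snd u)) (snd (snd u)))
        \<in> borel_measurable (lebesgue :: ((real \<times> real) \<times> (real \<times> real)) measure)
   \<and> set_integrable (lebesgue :: ((real \<times> real) \<times> (real \<times> real)) measure)
        (({0..1} \<times> {0..1}) \<times> ({0..1} \<times> {0..1}))
        (\<lambda>u. W (fst (fst u)) (snd (fst u)) (fst (snd u)) (snd (snd u)))"

definition avgw :: "(real \<Rightarrow> real \<Rightarrow> real \<Rightarrow> real \<Rightarrow> real) \<Rightarrow> real \<Rightarrow> real \<Rightarrow> real" where
  "avgw W x y = set_lebesgue_integral lebesgue ({0..1} \<times> {0..1})
      (\<lambda>st. W (fst st) (snd st) (frac (x + fst st)) (frac (y + snd st)))"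

end

theory Submission
  imports Defs "HOL-Probability.Probability_Measure"
begin

text \<open>
  Each of the five conditions bounds, over a family of rectangles, the mean of \<open>\<phi> (g / c)\<close> where \<open>c\<close>
  is the mean of the weight \<open>g\<close> and \<open>\<phi> \<ge> 0\<close> is convex on the positive half-line:
  \<open>x powr (-1/(p-1))\<close> for $A_p$, \<open>x - 1 - ln x\<close> for $A_\infty$, \<open>max 0 (1 - K x)\<close> with bound 0 for
  $A_1$, \<open>x powr p\<close> for $RH_p$ and \<open>max 0 (x - K)\<close> with bound 0 for $RH_\infty$.
  For a doubling weight such a bound passes from dyadic to arbitrary rectangles, because a rectangle
  is covered by disjoint dyadic ones of comparable size, over which the means of \<open>g\<close> are comparable.
  It then passes to averages of translated weights by Jensen's inequality, applied to the
  probability measure on the parameters whose density is proportional to the mean \<open>c\<close>.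
\<close>

subsection \<open>Means over sets of positive finite measure\<close>

lemma emeasure_eq_ennreal_measure_pos:
  assumes "0 < measure M A"
  shows "emeasure M A = ennreal (measure M A)"
  using assms by (intro emeasure_eq_ennreal_measure) (auto simp: measure_def)

lemma uniform_measure_eq_density:
  assumes "0 < measure M A"
  shows "uniform_measure M A = density M (\<lambda>x. ennreal (indicator A x / measure M A))"
proof -
  have "indicator A x / emeasure M A = ennreal (indicator A x / measure M A)" for x
    using assms
    by (simp add: emeasure_eq_ennreal_measure_pos divide_ennreal[symmetric] ennreal_indicator)
  then show ?thesis by (simp add: uniform_measure_def)
qed

lemma prob_space_uniform_measure_pos:
  assumes "0 < measure M A"
  shows "prob_space (uniform_measure M A)"
  using assms by (intro prob_space_uniform_measure) (auto simp: measure_def)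

lemma AE_uniform_measure_pos:
  assumes "0 < measure M A"
  shows "(AE x in uniform_measure M A. P x) \<longleftrightarrow> (AE x in M. x \<in> A \<longrightarrow> P x)"
  using assms by (intro AE_uniform_measure) (auto simp: measure_def less_top[symmetric])

lemma integrable_uniform_measure_iff:
  fixes f :: "'a \<Rightarrow> real"
  assumes "A \<in> sets M" "0 < measure M A" "f \<in> borel_measurable M"
  shows "integrable (uniform_measure M A) f \<longleftrightarrow> set_integrable M A f"
proof -
  have "integrable (uniform_measure M A) f
      \<longleftrightarrow> integrable M (\<lambda>x. (1 / measure M A) * (indicator A x *\<^sub>R f x))"
    using assms by (simp add: uniform_measure_eq_density integrable_density mult.commute)
  also have "\<dots> \<longleftrightarrow> set_integrable M A f"
    unfolding set_integrable_def using assms by (subst integrable_mult_left_iff) auto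
  finally show ?thesis .
qed

lemma integral_uniform_measure:
  fixes f :: "'a \<Rightarrow> real"
  assumes "A \<in> sets M" "0 < measure M A" "f \<in> borel_measurable M"
  shows "(\<integral>x. f x \<partial>uniform_measure M A) = set_lebesgue_integral M A f / measure M A"
  using assms
  by (simp add: uniform_measure_eq_density integral_density set_lebesgue_integral_def)

lemma nn_set_integral_eq_uniform_measure:
  assumes "A \<in> sets M" "f \<in> borel_measurable M" "0 < measure M A"
  shows "(\<integral>\<^sup>+x\<in>A. f x \<partial>M) = ennreal (measure M A) * (\<integral>\<^sup>+x. f x \<partial>uniform_measure M A)"
  using assms
  by (simp add: nn_integral_uniform_measure emeasure_eq_ennreal_measure_pos ennreal_times_divide
      mult_divide_eq_ennreal mult.commute[of "ennreal _"])

lemma nn_set_integral_cover_le: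
  assumes [measurable]: "f \<in> borel_measurable N" "\<And>i. i \<in> J \<Longrightarrow> D i \<in> sets N"
    and finite: "finite J" and cover: "R \<subseteq> (\<Union>i\<in>J. D i)"
  shows "(\<integral>\<^sup>+x\<in>R. f x \<partial>N) \<le> (\<Sum>i\<in>J. \<integral>\<^sup>+x\<in>D i. f x \<partial>N)"
proof -
  have indicator_le: "indicator R x \<le> (\<Sum>i\<in>J. indicator (D i) x :: ennreal)" for x
  proof (cases "x \<in> R")
    case True
    then obtain i where "i \<in> J" "x \<in> D i" using cover by auto
    then have "1 = (indicator (D i) x :: ennreal)" by simp
    also have "\<dots> \<le> (\<Sum>i\<in>J. indicator (D i) x)"
      using \<open>i \<in> J\<close> finite by (intro member_le_sum) auto
    finally show ?thesis using True by simp
  qed simp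
  have "(\<integral>\<^sup>+x\<in>R. f x \<partial>N) \<le> (\<integral>\<^sup>+x. (\<Sum>i\<in>J. f x * indicator (D i) x) \<partial>N)"
    unfolding sum_distrib_left[symmetric]
    by (intro nn_integral_mono mult_left_mono indicator_le) simp
  also have "\<dots> = (\<Sum>i\<in>J. \<integral>\<^sup>+x\<in>D i. f x \<partial>N)"
    by (rule nn_integral_sum) simp
  finally show ?thesis .
qed

lemma nn_integral_uniform_measure_cover_le:
  fixes f :: "'a \<Rightarrow> ennreal"
  assumes [measurable]: "f \<in> borel_measurable N" "R \<in> sets N" "\<And>i. i \<in> J \<Longrightarrow> D i \<in> sets N"
    and measure_pos: "0 < measure N R" "\<And>i. i \<in> J \<Longrightarrow> 0 < measure N (D i)"
    and finite: "finite J" and cover: "R \<subseteq> (\<Union>i\<in>J. D i)"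
    and total: "(\<Sum>i\<in>J. measure N (D i)) \<le> n * measure N R"
    and pieces: "\<And>i. i \<in> J \<Longrightarrow> (\<integral>\<^sup>+x. f x \<partial>uniform_measure N (D i)) \<le> L"
  shows "(\<integral>\<^sup>+x. f x \<partial>uniform_measure N R) \<le> ennreal n * L"
proof -
  have "ennreal (measure N R) * (\<integral>\<^sup>+x. f x \<partial>uniform_measure N R) = (\<integral>\<^sup>+x\<in>R. f x \<partial>N)"
    using measure_pos by (intro nn_set_integral_eq_uniform_measure[symmetric]) auto
  also have "\<dots> \<le> (\<Sum>i\<in>J. \<integral>\<^sup>+x\<in>D i. f x \<partial>N)"
    using finite cover by (intro nn_set_integral_cover_le) auto
  also have "\<dots> = (\<Sum>i\<in>J. ennreal (measure N (D i)) * (\<integral>\<^sup>+x. f x \<partial>uniform_measure N (D i)))"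
    using measure_pos by (intro sum.cong refl nn_set_integral_eq_uniform_measure) auto
  also have "\<dots> \<le> (\<Sum>i\<in>J. ennreal (measure N (D i)) * L)"
    by (intro sum_mono mult_left_mono pieces) simp_all
  also have "\<dots> = ennreal (\<Sum>i\<in>J. measure N (D i)) * L"
    by (simp add: sum_distrib_right[symmetric])
  also have "\<dots> \<le> ennreal (n * measure N R) * L"
    by (intro mult_right_mono ennreal_leI total) simp
  also have "\<dots> = ennreal (measure N R) * (ennreal n * L)"
    by (simp add: ennreal_mult'' mult_ac)
  finally show ?thesis
    using measure_pos by (simp add: ennreal_mult_le_mult_iff)
qed

subsection \<open>Normalized moments\<close>

definition normalized_moment :: "(real \<Rightarrow> real) \<Rightarrow> 'a measure \<Rightarrow> ('a \<Rightarrow> real) \<Rightarrow> ennreal" where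
  "normalized_moment \<phi> N X = (\<integral>\<^sup>+z. ennreal (\<phi> (X z / (\<integral>x. X x \<partial>N))) \<partial>N)"

lemma normalized_moment_cong_AE:
  assumes "X \<in> borel_measurable N" "Y \<in> borel_measurable N" "AE z in N. X z = Y z"
  shows "normalized_moment \<phi> N X = normalized_moment \<phi> N Y"
  unfolding normalized_moment_def integral_cong_AE[OF assms]
  using assms(3) by (intro nn_integral_cong_AE) (auto elim!: eventually_mono)

lemma nn_integral_ennreal_le_iff:
  fixes f :: "'a \<Rightarrow> real"
  assumes f_meas: "f \<in> borel_measurable M" "AE x in M. 0 \<le> f x" and L_nonneg: "0 \<le> L"
  shows "(\<integral>\<^sup>+x. ennreal (f x) \<partial>M) \<le> ennreal L \<longleftrightarrow> integrable M f \<and> (\<integral>x. f x \<partial>M) \<le> L"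
proof (cases "integrable M f")
  case True
  then show ?thesis using f_meas(2) L_nonneg by (simp add: nn_integral_eq_integral)
next
  case False
  then have "(\<integral>\<^sup>+x. ennreal (f x) \<partial>M) = top"
    using integrableI_nonneg[OF f_meas] by (auto simp: top.not_eq_extremum[symmetric])
  then show ?thesis using False by (simp add: top_unique)
qed

context prob_space
begin

lemma normalized_moment_powr_le_iff:
  assumes X: "integrable M X" "AE z in M. 0 < X z" and L_nonneg: "0 \<le> L"
  shows "normalized_moment (\<lambda>x. x powr a) M X \<le> ennreal L \<longleftrightarrow>
    integrable M (\<lambda>z. X z powr a) \<and> expectation (\<lambda>z. X z powr a) \<le> L * expectation X powr a"
proof -
  let ?c = "expectation X"
  have [measurable]: "X \<in> borel_measurable M" using X by auto
  have mean_pos: "0 < ?c" by (rule expectation_greater[OF X])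
  have "normalized_moment (\<lambda>x. x powr a) M X = (\<integral>\<^sup>+z. ennreal (X z powr a / ?c powr a) \<partial>M)"
    unfolding normalized_moment_def using X(2) mean_pos
    by (intro nn_integral_cong_AE) (auto simp: powr_divide)
  also have "\<dots> \<le> ennreal L \<longleftrightarrow>
      integrable M (\<lambda>z. X z powr a / ?c powr a) \<and> expectation (\<lambda>z. X z powr a / ?c powr a) \<le> L"
    using L_nonneg by (intro nn_integral_ennreal_le_iff) auto
  also have "integrable M (\<lambda>z. X z powr a / ?c powr a) \<longleftrightarrow> integrable M (\<lambda>z. X z powr a)"
    using mean_pos by (simp add: divide_inverse)
  also have "expectation (\<lambda>z. X z powr a / ?c powr a) \<le> L
      \<longleftrightarrow> expectation (\<lambda>z. X z powr a) \<le> L * ?c powr a"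
    using mean_pos by (simp add: pos_divide_le_eq)
  finally show ?thesis .
qed

lemma normalized_moment_ln_le_iff:
  assumes X: "integrable M X" "AE z in M. 0 < X z" and L_nonneg: "0 \<le> L"
  shows "normalized_moment (\<lambda>x. x - 1 - ln x) M X \<le> ennreal L \<longleftrightarrow>
    integrable M (\<lambda>z. ln (1 / X z)) \<and> ln (expectation X) + expectation (\<lambda>z. ln (1 / X z)) \<le> L"
proof -
  let ?c = "expectation X" and ?f = "\<lambda>z. X z / expectation X - 1 - ln (X z / expectation X)"
  let ?l = "\<lambda>z. X z / expectation X - 1 + ln (expectation X)"
  have [measurable]: "X \<in> borel_measurable M" using X by auto
  have mean_pos: "0 < ?c" by (rule expectation_greater[OF X])
  have affine: "integrable M ?l" "expectation ?l = ln ?c"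
    using X mean_pos by (simp_all add: prob_space)
  have "AE z in M. 0 \<le> ?f z"
    using X(2)
  proof eventually_elim
    case (elim z)
    then show ?case using ln_le_minus_one[of "X z / ?c"] mean_pos by simp
  qed
  then have "normalized_moment (\<lambda>x. x - 1 - ln x) M X \<le> ennreal L
      \<longleftrightarrow> integrable M ?f \<and> expectation ?f \<le> L"
    unfolding normalized_moment_def using L_nonneg by (intro nn_integral_ennreal_le_iff) auto
  moreover have split: "AE z in M. ?f z = ?l z + ln (1 / X z)"
    using X(2) by eventually_elim (use mean_pos in \<open>simp add: ln_div\<close>)
  have "integrable M ?f \<longleftrightarrow> integrable M (\<lambda>z. ?l z + ln (1 / X z))"
    using split by (intro integrable_cong_AE) auto
  moreover have "expectation ?f = expectation (\<lambda>z. ?l z + ln (1 / X z))"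
    using split by (intro integral_cong_AE) auto
  moreover have "integrable M (\<lambda>z. ?l z + ln (1 / X z)) \<longleftrightarrow> integrable M (\<lambda>z. ln (1 / X z))"
    using Bochner_Integration.integrable_diff[OF _ affine(1), of "\<lambda>z. ?l z + ln (1 / X z)"]
      Bochner_Integration.integrable_add[OF affine(1), of "\<lambda>z. ln (1 / X z)"] by auto
  moreover have "expectation (\<lambda>z. ?l z + ln (1 / X z)) = ln ?c + expectation (\<lambda>z. ln (1 / X z))"
    if "integrable M (\<lambda>z. ln (1 / X z))"
    using Bochner_Integration.integral_add[OF affine(1) that] by (simp only: affine(2))
  ultimately show ?thesis by auto
qed

lemma normalized_moment_le_0_iff:
  assumes [measurable]: "X \<in> borel_measurable M" "\<phi> \<in> borel_measurable borel"
  shows "normalized_moment \<phi> M X \<le> 0 \<longleftrightarrow> (AE z in M. \<phi> (X z / expectation X) \<le> 0)"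
  unfolding normalized_moment_def
  by (subst le_zero_eq, subst nn_integral_0_iff_AE) (auto simp: ennreal_eq_0_iff)

end

text \<open>The term \<open>B * (x + 1)\<close> is there for \<open>x - 1 - ln x\<close>, to which a dilation adds an affine
  function; \<open>x + 1\<close> has normalized moment 2.\<close>

locale dilation_dominated =
  fixes M A B :: real and \<phi> \<psi> :: "real \<Rightarrow> real"
  assumes borel_measurable [measurable]: "\<phi> \<in> borel_measurable borel" "\<psi> \<in> borel_measurable borel"
    and nonneg: "\<And>x. 0 < x \<Longrightarrow> 0 \<le> \<phi> x" "\<And>x. 0 < x \<Longrightarrow> 0 \<le> \<psi> x" "0 \<le> A" "0 \<le> B"
    and convex: "convex_on {0<..} \<psi>"
    and dilate: "\<And>q x. 1 / M \<le> q \<Longrightarrow> q \<le> M \<Longrightarrow> 0 < x \<Longrightarrow> \<psi> (q * x) \<le> A * \<phi> x + B * (x + 1)"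
begin

lemma nn_integral_dilate_le:
  assumes "prob_space N" and X: "integrable N X" "AE z in N. 0 < X z" and c_pos: "0 < c"
    and ratio: "1 / M \<le> (\<integral>z. X z \<partial>N) / c" "(\<integral>z. X z \<partial>N) / c \<le> M"
  shows "(\<integral>\<^sup>+z. ennreal (\<psi> (X z / c)) \<partial>N) \<le> ennreal A * normalized_moment \<phi> N X + ennreal (2 * B)"
proof -
  interpret prob_space N by fact
  let ?e = "expectation X"
  have [measurable]: "X \<in> borel_measurable N" using X by auto
  have mean_pos: "0 < ?e" by (rule expectation_greater[OF X])
  have "(\<integral>\<^sup>+z. ennreal (\<psi> (X z / c)) \<partial>N)
      \<le> (\<integral>\<^sup>+z. ennreal A * ennreal (\<phi> (X z / ?e)) + ennreal (B * (X z / ?e + 1)) \<partial>N)"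
  proof (rule nn_integral_mono_AE)
    show "AE z in N. ennreal (\<psi> (X z / c))
        \<le> ennreal A * ennreal (\<phi> (X z / ?e)) + ennreal (B * (X z / ?e + 1))"
      using X(2)
    proof eventually_elim
      case (elim z)
      then have pos: "0 < X z / ?e" using mean_pos by simp
      have "\<psi> (X z / c) \<le> A * \<phi> (X z / ?e) + B * (X z / ?e + 1)"
        using dilate[OF ratio pos] mean_pos by simp
      then have "ennreal (\<psi> (X z / c)) \<le> ennreal (A * \<phi> (X z / ?e) + B * (X z / ?e + 1))"
        by (rule ennreal_leI)
      then show ?case
        using nonneg pos by (simp add: ennreal_mult)
    qed
  qed
  also have "\<dots> = ennreal A * normalized_moment \<phi> N X + (\<integral>\<^sup>+z. ennreal (B * (X z / ?e + 1)) \<partial>N)"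
    unfolding normalized_moment_def by (subst nn_integral_add) (auto simp: nn_integral_cmult)
  also have "(\<integral>\<^sup>+z. ennreal (B * (X z / ?e + 1)) \<partial>N) = ennreal (\<integral>z. B * (X z / ?e + 1) \<partial>N)"
    using X nonneg(4) mean_pos by (intro nn_integral_eq_integral) (auto elim!: eventually_mono)
  also have "(\<integral>z. B * (X z / ?e + 1) \<partial>N) = 2 * B"
    using X mean_pos prob_space by simp
  finally show ?thesis .
qed

end

subsection \<open>Jensen's inequality for averages\<close>

definition size_biased :: "'a measure \<Rightarrow> ('a \<Rightarrow> real) \<Rightarrow> 'a measure" where
  "size_biased M X = density M (\<lambda>s. ennreal (X s / (\<integral>s. X s \<partial>M)))"

lemma sets_size_biased [measurable_cong, simp]: "sets (size_biased M X) = sets M"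
  by (simp add: size_biased_def)

context prob_space
begin

context
  fixes X :: "'a \<Rightarrow> real"
  assumes X: "integrable M X" "AE s in M. 0 < X s"
begin

lemma prob_space_size_biased: "prob_space (size_biased M X)"
proof
  have [measurable]: "X \<in> borel_measurable M" using X by auto
  have mean_pos: "0 < expectation X" by (rule expectation_greater[OF X])
  have "emeasure (size_biased M X) (space (size_biased M X))
      = (\<integral>\<^sup>+s. ennreal (X s / expectation X) \<partial>M)"
    unfolding size_biased_def by (simp add: emeasure_density cong: nn_integral_cong)
  also have "\<dots> = ennreal (\<integral>s. X s / expectation X \<partial>M)"
    using X mean_pos by (intro nn_integral_eq_integral) (auto elim!: eventually_mono)
  also have "\<dots> = 1" using mean_pos by simp
  finally show "emeasure (size_biased M X) (space (size_biased M X)) = 1" .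
qed

lemma AE_size_biased:
  assumes "AE s in M. P s"
  shows "AE s in size_biased M X. P s"
  unfolding size_biased_def using X assms by (subst AE_density) auto

lemma has_expectation_size_biased:
  fixes Y :: "'a \<Rightarrow> real"
  assumes Y: "integrable M Y"
  shows "integrable (size_biased M X) (\<lambda>s. Y s / X s)"
    and "(\<integral>s. Y s / X s \<partial>size_biased M X) = expectation Y / expectation X"
proof -
  have [measurable]: "X \<in> borel_measurable M" "Y \<in> borel_measurable M" using X Y by auto
  have mean_pos: "0 < expectation X" by (rule expectation_greater[OF X])
  have density_nonneg: "AE s in M. 0 \<le> X s / expectation X"
    using X(2) by eventually_elim (use mean_pos in simp)
  have cancel: "AE s in M. (X s / expectation X) *\<^sub>R (Y s / X s) = Y s / expectation X"
    using X(2) by eventually_elim simp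
  have "integrable M (\<lambda>s. (X s / expectation X) *\<^sub>R (Y s / X s))
      \<longleftrightarrow> integrable M (\<lambda>s. Y s / expectation X)"
    using cancel by (intro integrable_cong_AE) auto
  then show "integrable (size_biased M X) (\<lambda>s. Y s / X s)"
    unfolding size_biased_def using density_nonneg Y by (simp add: integrable_density)
  have "(\<integral>s. Y s / X s \<partial>size_biased M X) = (\<integral>s. (X s / expectation X) *\<^sub>R (Y s / X s) \<partial>M)"
    unfolding size_biased_def using density_nonneg by (intro integral_density) auto
  also have "\<dots> = (\<integral>s. Y s / expectation X \<partial>M)"
    using cancel by (intro integral_cong_AE) auto
  finally show "(\<integral>s. Y s / X s \<partial>size_biased M X) = expectation Y / expectation X" by simp
qed

lemma jensens_inequality_size_biased:
  assumes Y: "integrable M Y" "AE s in M. 0 < Y s"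
    and \<phi>[measurable]: "\<phi> \<in> borel_measurable borel"
    and convex: "convex_on {0<..} \<phi>" and nonneg: "\<And>x. 0 < x \<Longrightarrow> 0 \<le> \<phi> x"
  shows "ennreal (\<phi> (expectation Y / expectation X))
      \<le> (\<integral>\<^sup>+s. ennreal (\<phi> (Y s / X s)) \<partial>size_biased M X)"
proof -
  interpret Q: prob_space "size_biased M X" by (rule prob_space_size_biased)
  have [measurable]: "X \<in> borel_measurable M" "Y \<in> borel_measurable M" using X Y by auto
  have pos: "AE s in size_biased M X. Y s / X s \<in> {0<..}"
    using AE_size_biased[OF X(2)] AE_size_biased[OF Y(2)] by eventually_elim simp
  then have \<phi>_nonneg: "AE s in size_biased M X. 0 \<le> \<phi> (Y s / X s)"
    by eventually_elim (simp add: nonneg)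
  show ?thesis
  proof (cases "integrable (size_biased M X) (\<lambda>s. \<phi> (Y s / X s))")
    case True
    have "\<phi> (Q.expectation (\<lambda>s. Y s / X s)) \<le> Q.expectation (\<lambda>s. \<phi> (Y s / X s))"
      by (rule Q.jensens_inequality[OF has_expectation_size_biased(1)[OF Y(1)] pos _ True convex]) blast
    then show ?thesis
      using True \<phi>_nonneg
      by (simp add: has_expectation_size_biased(2)[OF Y(1)] nn_integral_eq_integral ennreal_leI)
  next
    case False
    have "(\<lambda>s. \<phi> (Y s / X s)) \<in> borel_measurable (size_biased M X)" by measurable
    with False have "(\<integral>\<^sup>+s. ennreal (\<phi> (Y s / X s)) \<partial>size_biased M X) = top"
      using integrableI_nonneg[OF _ \<phi>_nonneg] by (metis infinity_ennreal_def top.not_eq_extremum)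
    then show ?thesis by simp
  qed
qed

end

end

lemma normalized_moment_average_le:
  fixes h :: "'a \<times> 'b \<Rightarrow> real"
  assumes P: "prob_space P" and N: "prob_space N"
    and h: "integrable (P \<Otimes>\<^sub>M N) h" "AE u in P \<Otimes>\<^sub>M N. 0 < h u"
    and \<phi>[measurable]: "\<phi> \<in> borel_measurable borel"
    and convex: "convex_on {0<..} \<phi>" and nonneg: "\<And>x. 0 < x \<Longrightarrow> 0 \<le> \<phi> x"
    and moments: "AE s in P. normalized_moment \<phi> N (\<lambda>z. h (s, z)) \<le> K"
  shows "normalized_moment \<phi> N (\<lambda>z. \<integral>s. h (s, z) \<partial>P) \<le> K"
proof -
  interpret P: prob_space P by fact
  interpret N: prob_space N by fact
  interpret PN: pair_prob_space P N ..
  have [measurable]: "h \<in> borel_measurable (P \<Otimes>\<^sub>M N)" using h by auto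
  define c where "c s = (\<integral>z. h (s, z) \<partial>N)" for s
  have c_integrable: "integrable P c" unfolding c_def by (rule PN.integrable_fst'[OF h(1)])
  have [measurable]: "c \<in> borel_measurable P" using c_integrable by auto
  have c_pos: "AE s in P. 0 < c s"
    using PN.AE_integrable_fst'[OF h(1)] PN.AE_pair[OF h(2)]
    by eventually_elim (auto simp: c_def intro!: N.expectation_greater)
  have mean: "(\<integral>z. \<integral>s. h (s, z) \<partial>P \<partial>N) = P.expectation c"
    unfolding c_def using PN.Fubini_integral[of "\<lambda>s z. h (s, z)"] h(1) by simp
  interpret Q: prob_space "size_biased P c"
    by (rule P.prob_space_size_biased[OF c_integrable c_pos])
  interpret QN: pair_prob_space "size_biased P c" N ..
  have "AE z in N. AE s in P. 0 < h (s, z)"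
    using PN.AE_pair[OF h(2)] PN.AE_commute[of "\<lambda>s z. 0 < h (s, z)"] by simp
  then have "AE z in N. ennreal (\<phi> ((\<integral>s. h (s, z) \<partial>P) / P.expectation c))
      \<le> (\<integral>\<^sup>+s. ennreal (\<phi> (h (s, z) / c s)) \<partial>size_biased P c)"
    using PN.AE_integrable_snd[of "\<lambda>s z. h (s, z)", simplified, OF h(1)]
    by eventually_elim
      (rule P.jensens_inequality_size_biased[OF c_integrable c_pos _ _ \<phi> convex nonneg])
  then have "normalized_moment \<phi> N (\<lambda>z. \<integral>s. h (s, z) \<partial>P)
      \<le> (\<integral>\<^sup>+z. \<integral>\<^sup>+s. ennreal (\<phi> (h (s, z) / c s)) \<partial>size_biased P c \<partial>N)"
    unfolding normalized_moment_def mean by (rule nn_integral_mono_AE)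
  also have "\<dots> = (\<integral>\<^sup>+s. normalized_moment \<phi> N (\<lambda>z. h (s, z)) \<partial>size_biased P c)"
    unfolding normalized_moment_def c_def[symmetric] by (rule QN.Fubini') measurable
  also have "\<dots> \<le> (\<integral>\<^sup>+s. K \<partial>size_biased P c)"
    by (intro nn_integral_mono_AE P.AE_size_biased[OF c_integrable c_pos moments])
  finally show ?thesis by (simp add: Q.emeasure_space_1)
qed

subsection \<open>Dyadic intervals and rectangles\<close>

lemma measure_lebesgue_Times:
  fixes A :: "'a::euclidean_space set" and B :: "'b::euclidean_space set"
  assumes "A \<in> sets borel" "B \<in> sets borel"
  shows "measure lebesgue (A \<times> B) = measure lebesgue A * measure lebesgue B"
proof -
  have "emeasure lborel (A \<times> B) = emeasure lborel A * emeasure lborel B"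
    using assms lborel.emeasure_pair_measure_Times[of A lborel B] by (simp add: lborel_prod)
  then show ?thesis using assms by (simp add: measure_def enn2real_mult borel_Times)
qed

lemma lebesgue_Times [intro]:
  fixes A :: "'a::euclidean_space set" and B :: "'b::euclidean_space set"
  assumes "A \<in> sets borel" "B \<in> sets borel"
  shows "A \<times> B \<in> sets lebesgue"
  using assms by (intro sets_completionI_sets) (simp add: borel_Times)

lemma measure_lebesgue_cball_Times:
  fixes x y :: real
  assumes "0 \<le> r" "0 \<le> s"
  shows "measure lebesgue (cball x r \<times> cball y s) = 4 * (r * s)"
  using assms by (simp add: measure_lebesgue_Times cball_eq_atLeastAtMost)

lemma torus_rectE:
  assumes "R \<in> torus_rects"
  obtains x y r s where "R = cball x r \<times> cball y s" "0 < r" "r \<le> 1/2" "0 < s" "s \<le> 1/2"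
proof -
  obtain a b l m where R: "R = {a..a+l} \<times> {b..b+m}" and lengths: "0 < l" "l \<le> 1" "0 < m" "m \<le> 1"
    using assms unfolding torus_rects_def by blast
  have "R = cball (a + l/2) (l/2) \<times> cball (b + m/2) (m/2)"
    by (simp add: R cball_eq_atLeastAtMost add.assoc)
  then show ?thesis using lengths that[of "a + l/2" "l/2" "b + m/2" "m/2"] by simp
qed

lemma torus_rect_borel: "R \<in> torus_rects \<Longrightarrow> R \<in> sets borel"
  by (auto elim!: torus_rectE intro!: borel_Times)

lemma torus_rect_measure_pos: "R \<in> torus_rects \<Longrightarrow> 0 < measure lebesgue R"
  by (auto elim!: torus_rectE simp: measure_lebesgue_cball_Times)

definition dyadic_interval :: "nat \<Rightarrow> int \<Rightarrow> real set" where
  "dyadic_interval k i = {of_int i / 2^k ..< (of_int i + 1) / 2^k}"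

lemma mem_dyadic_interval_iff: "x \<in> dyadic_interval k i \<longleftrightarrow> \<lfloor>x * 2^k\<rfloor> = i"
  by (auto simp: dyadic_interval_def floor_eq_iff field_simps)

lemma borel_dyadic_interval [measurable, simp]: "dyadic_interval k i \<in> sets borel"
  by (simp add: dyadic_interval_def)

lemma measure_dyadic_rect:
  "measure lebesgue (dyadic_interval k i \<times> dyadic_interval l j) = 1/2^k * (1/2^l)"
proof -
  have "measure lebesgue (dyadic_interval k i) = 1/2^k" for k i
    by (simp add: dyadic_interval_def divide_simps)
  then show ?thesis by (simp add: measure_lebesgue_Times)
qed

lemma finite_dyadic_intervals_meeting_cball: "finite {i. dyadic_interval k i \<inter> cball x r \<noteq> {}}"
proof (rule finite_subset)
  show "{i. dyadic_interval k i \<inter> cball x r \<noteq> {}} \<subseteq> {\<lfloor>(x - r) * 2^k\<rfloor>..\<lfloor>(x + r) * 2^k\<rfloor>}"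
    by (auto simp: mem_dyadic_interval_iff cball_eq_atLeastAtMost intro!: floor_mono mult_right_mono)
qed simp

lemma obtain_dyadic_scale:
  assumes "0 < r" "r \<le> (1::real)"
  obtains k where "r / 2 < 1/2^k" "1/2^k \<le> r"
proof -
  define k where "k = nat \<lceil>log 2 (1 / r)\<rceil>"
  have "0 \<le> log 2 (1 / r)" using assms by simp
  then have k_bounds: "log 2 (1 / r) \<le> real k" "real k < log 2 (1 / r) + 1"
    unfolding k_def by linarith+
  have "1 / r \<le> 2 powr real k" using k_bounds(1) assms by (simp add: log_le_iff)
  moreover have "2 powr real k < 2 powr (log 2 (1 / r) + 1)" using k_bounds(2) by simp
  then have "2 powr real k < 2 / r" using assms by (simp add: powr_add)
  ultimately show ?thesis using assms by (intro that[of k]) (auto simp: powr_realpow field_simps)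
qed

lemma dyadic_interval_meeting_cball:
  fixes x r :: real
  assumes scale: "r / 2 < 1/2^k" "1/2^k \<le> r" and meets: "dyadic_interval k i \<inter> cball x r \<noteq> {}"
  defines "c \<equiv> (of_int i + 1/2) / 2^k"
  shows "dyadic_interval k i \<subseteq> cball x (2 * r)"
    and "cball c (r/4) \<subseteq> dyadic_interval k i"
    and "cball x (r/2) \<subseteq> cball c (2 * r)"
proof -
  define d where "d = 1 / (2::real)^k"
  have "c = of_int i * d + d/2" "dyadic_interval k i = {of_int i * d..<of_int i * d + d}"
    by (simp_all add: c_def d_def dyadic_interval_def add_divide_distrib)
  then have interval: "dyadic_interval k i = {c - d/2..<c + d/2}" by (simp add: add.commute)
  have d_bounds: "r/2 < d" "d \<le> r" using scale by (simp_all add: d_def)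
  have "\<bar>x - c\<bar> \<le> r + d/2"
    using meets by (auto simp: interval cball_eq_atLeastAtMost)
  then show "dyadic_interval k i \<subseteq> cball x (2 * r)" "cball c (r/4) \<subseteq> dyadic_interval k i"
    "cball x (r/2) \<subseteq> cball c (2 * r)"
    using d_bounds by (auto simp: interval cball_eq_atLeastAtMost)
qed

locale dyadic_tiling =
  fixes x y r s :: real and k l :: nat
  assumes radius_x: "0 < r" "r \<le> 1/2" and radius_y: "0 < s" "s \<le> 1/2"
    and scale_x: "r / 2 < 1/2^k" "1/2^k \<le> r" and scale_y: "s / 2 < 1/2^l" "1/2^l \<le> s"
begin

definition rect :: "(real \<times> real) set" where
  "rect = cball x r \<times> cball y s"

definition tile :: "int \<times> int \<Rightarrow> (real \<times> real) set" where
  "tile p = dyadic_interval k (fst p) \<times> dyadic_interval l (snd p)"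

definition tiles :: "(int \<times> int) set" where
  "tiles = {i. dyadic_interval k i \<inter> cball x r \<noteq> {}} \<times> {j. dyadic_interval l j \<inter> cball y s \<noteq> {}}"

lemma lmeasurable_rect: "rect \<in> lmeasurable"
  by (auto simp: rect_def intro!: bounded_Times bounded_set_imp_lmeasurable)

lemma measure_rect: "measure lebesgue rect = 4 * (r * s)"
  using radius_x radius_y by (simp add: rect_def measure_lebesgue_cball_Times)

lemma lebesgue_tile [measurable, simp]: "tile p \<in> sets lebesgue"
  by (auto simp: tile_def)

lemma measure_tile_bounds:
  "measure lebesgue rect < 16 * measure lebesgue (tile p)"
  "4 * measure lebesgue (tile p) \<le> measure lebesgue rect"
proof -
  have "(r/2) * (s/2) < 1/2^k * (1/2^l)"
    using scale_x scale_y radius_x radius_y by (intro mult_strict_mono) auto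
  moreover have "1/2^k * (1/2^l) \<le> r * s"
    using scale_x scale_y radius_x radius_y by (intro mult_mono) auto
  ultimately show "measure lebesgue rect < 16 * measure lebesgue (tile p)"
    "4 * measure lebesgue (tile p) \<le> measure lebesgue rect"
    by (simp_all add: measure_rect tile_def measure_dyadic_rect)
qed

lemma measure_tile_pos: "0 < measure lebesgue (tile p)"
  by (simp add: tile_def measure_dyadic_rect)

lemma finite_tiles: "finite tiles"
  unfolding tiles_def by (intro finite_cartesian_product finite_dyadic_intervals_meeting_cball)

lemma rect_subset_tiles: "rect \<subseteq> (\<Union>p\<in>tiles. tile p)"
  by (auto simp: rect_def tiles_def tile_def disjoint_iff mem_dyadic_interval_iff)

lemma tile_subset_double_rect: "p \<in> tiles \<Longrightarrow> tile p \<subseteq> cball x (2 * r) \<times> cball y (2 * s)"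
  unfolding tile_def
  by (intro Sigma_mono dyadic_interval_meeting_cball(1)[OF scale_x]
      dyadic_interval_meeting_cball(1)[OF scale_y])
    (simp_all add: tiles_def mem_Times_iff)

lemma lmeasurable_double_rect: "cball x (2 * r) \<times> cball y (2 * s) \<in> lmeasurable"
  by (auto intro!: bounded_Times bounded_set_imp_lmeasurable)

lemma bounded_tile: "p \<in> tiles \<Longrightarrow> bounded (tile p)"
  by (rule bounded_subset[OF _ tile_subset_double_rect]) (auto intro: bounded_Times)

lemma box_in_tile:
  assumes "p \<in> tiles"
  obtains c e where "cball c (r/4) \<times> cball e (s/4) \<subseteq> tile p"
    and "cball x (r/2) \<times> cball y (s/2) \<subseteq> cball c (2 * r) \<times> cball e (2 * s)"
proof -
  have meets: "dyadic_interval k (fst p) \<inter> cball x r \<noteq> {}"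
    "dyadic_interval l (snd p) \<inter> cball y s \<noteq> {}"
    using assms by (auto simp: tiles_def)
  note interval_x = dyadic_interval_meeting_cball[OF scale_x meets(1)]
    and interval_y = dyadic_interval_meeting_cball[OF scale_y meets(2)]
  show ?thesis
    using Sigma_mono[OF interval_x(2) interval_y(2)] Sigma_mono[OF interval_x(3) interval_y(3)] that
    unfolding tile_def by blast
qed

lemma sum_measure_tiles_le: "(\<Sum>p\<in>tiles. measure lebesgue (tile p)) \<le> 4 * measure lebesgue rect"
proof -
  have "(\<Sum>p\<in>tiles. measure lebesgue (tile p)) = measure lebesgue (\<Union>p\<in>tiles. tile p)"
  proof (rule measure_UNION_AE[symmetric, OF finite_tiles])
    show "tile p \<in> lmeasurable" if "p \<in> tiles" for p
      using that by (intro bounded_set_imp_lmeasurable bounded_tile) auto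
    show "pairwise (\<lambda>p q. AE z in lebesgue. z \<notin> tile p \<or> z \<notin> tile q) tiles"
      by (auto simp: pairwise_def tile_def mem_dyadic_interval_iff)
  qed
  also have "\<dots> \<le> measure lebesgue (cball x (2 * r) \<times> cball y (2 * s))"
    using tile_subset_double_rect finite_tiles
    by (intro measure_mono_fmeasurable lmeasurable_double_rect) auto
  also have "\<dots> = 4 * measure lebesgue rect"
    using radius_x radius_y by (simp add: measure_rect measure_lebesgue_cball_Times)
  finally show ?thesis .
qed

end

lemma torus_rect_tilingE:
  assumes "R \<in> torus_rects"
  obtains x y r s k l where "dyadic_tiling r s k l" "R = dyadic_tiling.rect x y r s"
proof -
  obtain x y r s where R: "R = cball x r \<times> cball y s"
    and radius_x: "0 < r" "r \<le> 1/2" and radius_y: "0 < s" "s \<le> 1/2"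
    using assms by (rule torus_rectE)
  obtain k where scale_x: "r / 2 < 1/2^k" "1/2^k \<le> r"
    using obtain_dyadic_scale[of r] radius_x by auto
  obtain l where scale_y: "s / 2 < 1/2^l" "1/2^l \<le> s"
    using obtain_dyadic_scale[of s] radius_y by auto
  have "dyadic_tiling r s k l" using radius_x radius_y scale_x scale_y by unfold_locales
  then show ?thesis using R that by (simp add: dyadic_tiling.rect_def)
qed

subsection \<open>Means of weights\<close>

definition sup_moment :: "(real \<Rightarrow> real) \<Rightarrow> (real \<times> real) set set \<Rightarrow> (real \<times> real \<Rightarrow> real) \<Rightarrow> ennreal" where
  "sup_moment \<phi> \<R> g = (SUP R\<in>\<R>. normalized_moment \<phi> (uniform_measure lebesgue R) g)"

locale weight_on =
  fixes \<R> :: "(real \<times> real) set set" and g :: "real \<times> real \<Rightarrow> real"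
  assumes sets: "R \<in> \<R> \<Longrightarrow> R \<in> sets lebesgue" and measure_pos: "R \<in> \<R> \<Longrightarrow> 0 < measure lebesgue R"
    and measurable [measurable]: "g \<in> borel_measurable lebesgue"
    and set_integrable: "R \<in> \<R> \<Longrightarrow> set_integrable lebesgue R g"
    and pos: "R \<in> \<R> \<Longrightarrow> AE z in lebesgue. z \<in> R \<longrightarrow> 0 < g z"
begin

context
  fixes R assumes R: "R \<in> \<R>"
begin

interpretation prob_space "uniform_measure lebesgue R"
  by (rule prob_space_uniform_measure_pos[OF measure_pos[OF R]])

lemma avg_eq_expectation: "k \<in> borel_measurable lebesgue \<Longrightarrow> avg R k = expectation k"
  by (simp add: avg_def integral_uniform_measure sets[OF R] measure_pos[OF R])

lemma set_integrable_iff: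
  "k \<in> borel_measurable lebesgue \<Longrightarrow> set_integrable lebesgue R k
      \<longleftrightarrow> integrable (uniform_measure lebesgue R) k"
  for k :: "real \<times> real \<Rightarrow> real"
  by (simp add: integrable_uniform_measure_iff sets[OF R] measure_pos[OF R])

lemma integrable_pos:
  "integrable (uniform_measure lebesgue R) g" "AE z in uniform_measure lebesgue R. 0 < g z"
  using set_integrable[OF R] pos[OF R] measure_pos[OF R]
  by (simp_all add: set_integrable_iff AE_uniform_measure_pos)

lemma avg_pos: "0 < avg R g"
  using expectation_greater[OF integrable_pos] by (simp add: avg_eq_expectation)

lemma avg_powr_nonneg: "0 \<le> avg R (\<lambda>z. g z powr a)"
  by (simp add: avg_eq_expectation)

lemma normalized_moment_powr_le_iff_avg:
  assumes "0 \<le> L"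
  shows "normalized_moment (\<lambda>x. x powr a) (uniform_measure lebesgue R) g \<le> ennreal L \<longleftrightarrow>
    set_integrable lebesgue R (\<lambda>z. g z powr a) \<and> avg R (\<lambda>z. g z powr a) \<le> L * avg R g powr a"
  using normalized_moment_powr_le_iff[OF integrable_pos assms, of a]
  by (simp add: set_integrable_iff avg_eq_expectation)

lemma normalized_moment_ln_le_iff_avg:
  assumes "1 \<le> K"
  shows "normalized_moment (\<lambda>x. x - 1 - ln x) (uniform_measure lebesgue R) g \<le> ennreal (ln K) \<longleftrightarrow>
    set_integrable lebesgue R (\<lambda>z. ln (1 / g z)) \<and> avg R g * exp (avg R (\<lambda>z. ln (1 / g z))) \<le> K"
proof -
  have "avg R g * exp y \<le> K \<longleftrightarrow> ln (avg R g) + y \<le> ln K" for y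
    using avg_pos assms by (simp add: ln_mult ln_le_cancel_iff[symmetric] del: ln_le_cancel_iff)
  then show ?thesis
    using normalized_moment_ln_le_iff[OF integrable_pos, of "ln K"] assms
    by (simp add: set_integrable_iff avg_eq_expectation)
qed

lemma normalized_moment_le_0_iff_avg:
  assumes [measurable]: "\<phi> \<in> borel_measurable borel"
  shows "normalized_moment \<phi> (uniform_measure lebesgue R) g \<le> 0 \<longleftrightarrow>
    (AE z in lebesgue. z \<in> R \<longrightarrow> \<phi> (g z / avg R g) \<le> 0)"
proof -
  have "normalized_moment \<phi> (uniform_measure lebesgue R) g \<le> 0 \<longleftrightarrow>
      (AE z in uniform_measure lebesgue R. \<phi> (g z / expectation g) \<le> 0)"
    by (rule normalized_moment_le_0_iff) simp_all
  then show ?thesis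
    by (simp add: AE_uniform_measure_pos measure_pos[OF R] avg_eq_expectation)
qed

end

end

subsection \<open>Doubling weights\<close>

locale doubling_weight =
  fixes C :: real and g :: "real \<times> real \<Rightarrow> real"
  assumes measurable [measurable]: "g \<in> borel_measurable lebesgue"
    and pos: "AE z in lebesgue. 0 < g z"
    and set_integrable_bounded: "bounded S \<Longrightarrow> S \<in> sets lebesgue \<Longrightarrow> set_integrable lebesgue S g"
    and doubling: "doubling C g"
begin

abbreviation mass :: "(real \<times> real) set \<Rightarrow> real" where
  "mass S \<equiv> set_lebesgue_integral lebesgue S g"

lemma mass_mono:
  assumes "S \<subseteq> T" "bounded T" "S \<in> sets lebesgue" "T \<in> sets lebesgue"
  shows "mass S \<le> mass T"
  unfolding set_lebesgue_integral_def
proof (rule integral_mono_AE)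
  show "AE z in lebesgue. indicat_real S z *\<^sub>R g z \<le> indicat_real T z *\<^sub>R g z"
    using pos by eventually_elim (use assms(1) in \<open>auto simp: indicator_def\<close>)
qed (use assms set_integrable_bounded bounded_subset[OF assms(2,1)] in \<open>auto simp: set_integrable_def\<close>)

sublocale bounded_sets: weight_on "{S. bounded S \<and> S \<in> sets lebesgue \<and> 0 < measure lebesgue S}" g
  using pos by unfold_locales (auto intro: set_integrable_bounded elim: eventually_mono)

lemma mass_cball_double_le:
  assumes "0 < r" "r \<le> 1/2" "0 < s" "s \<le> 1/2"
  shows "mass (cball x (2 * r) \<times> cball y (2 * s)) \<le> C * mass (cball x r \<times> cball y s)"
proof -
  have "{x - r - 2*r/2 .. x - r + 3*(2*r)/2} = cball x (2 * r)"
    "{x - r .. x - r + 2*r} = cball x r" for x r :: real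
    by (auto simp: cball_eq_atLeastAtMost)
  then show ?thesis
    using doubling[unfolded doubling_def, rule_format, of "2 * r" "2 * s" "x - r" "y - s"] assms
    by simp
qed

lemma doubling_constant_ge_1: "1 \<le> C"
proof -
  let ?Q = "\<lambda>r. cball 0 r \<times> cball (0::real) r"
  have "mass (?Q (1/2)) \<le> mass (?Q 1)" by (intro mass_mono bounded_Times lebesgue_Times) auto
  also have "\<dots> \<le> C * mass (?Q (1/2))" using mass_cball_double_le[of "1/2" "1/2"] by simp
  finally have "mass (?Q (1/2)) \<le> C * mass (?Q (1/2))" .
  moreover have "0 < avg (?Q (1/2)) g"
    by (rule bounded_sets.avg_pos) (auto simp: measure_lebesgue_cball_Times intro: bounded_Times)
  then have "0 < mass (?Q (1/2))" by (simp add: avg_def measure_lebesgue_cball_Times)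
  ultimately show ?thesis by simp
qed

lemma mass_cball_power_le:
  assumes "0 < r" "2^n * r \<le> 1" "0 < s" "2^n * s \<le> 1"
  shows "mass (cball x (2^n * r) \<times> cball y (2^n * s)) \<le> C^n * mass (cball x r \<times> cball y s)"
  using assms(2,4)
proof (induction n)
  case (Suc n)
  have small: "2^n * r \<le> 1/2" "2^n * s \<le> 1/2" using Suc.prems by simp_all
  have "mass (cball x (2^Suc n * r) \<times> cball y (2^Suc n * s))
      \<le> C * mass (cball x (2^n * r) \<times> cball y (2^n * s))"
    using mass_cball_double_le[of "2^n * r" "2^n * s" x y] assms small by (simp add: mult.assoc)
  also have "\<dots> \<le> C * (C^n * mass (cball x r \<times> cball y s))"
    using doubling_constant_ge_1 small by (intro mult_left_mono Suc.IH) auto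
  finally show ?case by (simp add: mult.assoc)
qed simp

end

locale tiled_doubling_weight = doubling_weight C g + dyadic_tiling x y r s k l for C g x y r s k l
begin

lemma mass_tile_le:
  assumes "p \<in> tiles"
  shows "mass (tile p) \<le> C * mass rect"
proof -
  have "mass (tile p) \<le> mass (cball x (2 * r) \<times> cball y (2 * s))"
    using tile_subset_double_rect[OF assms] by (intro mass_mono bounded_Times lebesgue_Times) auto
  also have "\<dots> \<le> C * mass rect"
    unfolding rect_def by (rule mass_cball_double_le[OF radius_x radius_y])
  finally show ?thesis .
qed

text \<open>Doubling is only available for sides up to 1, so the rectangle is first halved:
  its half lies in three doublings of a box inside the tile.\<close>

lemma mass_rect_le:
  assumes "p \<in> tiles"
  shows "mass rect \<le> C^4 * mass (tile p)"
proof -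
  have C_ge_1: "1 \<le> C" by (rule doubling_constant_ge_1)
  obtain c e where box: "cball c (r/4) \<times> cball e (s/4) \<subseteq> tile p"
    and half: "cball x (r/2) \<times> cball y (s/2) \<subseteq> cball c (2 * r) \<times> cball e (2 * s)"
    using assms by (rule box_in_tile)
  have "mass rect \<le> C * mass (cball x (r/2) \<times> cball y (s/2))"
    using mass_cball_double_le[of "r/2" "s/2" x y] radius_x radius_y by (simp add: rect_def)
  also have "mass (cball x (r/2) \<times> cball y (s/2))
      \<le> mass (cball c (2^3 * (r/4)) \<times> cball e (2^3 * (s/4)))"
    using half by (intro mass_mono bounded_Times lebesgue_Times) auto
  also have "\<dots> \<le> C^3 * mass (cball c (r/4) \<times> cball e (s/4))"
    using radius_x radius_y by (intro mass_cball_power_le) auto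
  also have "mass (cball c (r/4) \<times> cball e (s/4)) \<le> mass (tile p)"
    using box assms by (intro mass_mono bounded_tile lebesgue_Times) auto
  finally show ?thesis
    using C_ge_1 by (simp add: mult_left_mono power4_eq_xxxx power3_eq_cube)
qed

lemma rect_mem_bounded_sets: "rect \<in> {S. bounded S \<and> S \<in> sets lebesgue \<and> 0 < measure lebesgue S}"
proof -
  have "bounded rect" by (auto simp: rect_def intro: bounded_Times)
  moreover have "0 < measure lebesgue rect" using radius_x radius_y by (simp add: measure_rect)
  ultimately show ?thesis using lmeasurable_rect by (simp add: fmeasurableD)
qed

lemma tile_mem_bounded_sets:
  "p \<in> tiles \<Longrightarrow> tile p \<in> {S. bounded S \<and> S \<in> sets lebesgue \<and> 0 < measure lebesgue S}"
  by (simp add: bounded_tile measure_tile_pos)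

lemma avg_rect_pos: "0 < avg rect g"
  by (rule bounded_sets.avg_pos[OF rect_mem_bounded_sets])

lemma avg_tile_comparable:
  assumes p: "p \<in> tiles"
  shows "1 / (16 * C^4) \<le> avg (tile p) g / avg rect g" "avg (tile p) g / avg rect g \<le> 16 * C^4"
proof -
  have C_ge_1: "1 \<le> C" by (rule doubling_constant_ge_1)
  define q where "q = measure lebesgue rect / measure lebesgue (tile p)"
  have q_bounds: "1 \<le> q" "q \<le> 16"
    using measure_tile_bounds[of p] measure_tile_pos[of p] by (simp_all add: q_def field_simps)
  have mass_pos: "0 < mass rect"
    using avg_rect_pos rect_mem_bounded_sets by (simp add: avg_def zero_less_divide_iff)
  have ratio: "avg (tile p) g / avg rect g = mass (tile p) / mass rect * q"
    by (simp add: avg_def q_def)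
  have lower: "1 / C^4 \<le> mass (tile p) / mass rect"
    using mass_rect_le[OF p] mass_pos C_ge_1 by (simp add: field_simps)
  have "1 / (16 * C^4) \<le> 1 / C^4" using C_ge_1 by (simp add: divide_simps)
  also have "\<dots> = 1 / C^4 * 1" by simp
  also have "\<dots> \<le> mass (tile p) / mass rect * q"
    using lower order_trans[OF _ lower, of 0] C_ge_1 q_bounds by (intro mult_mono) auto
  finally show "1 / (16 * C^4) \<le> avg (tile p) g / avg rect g" unfolding ratio .
  have "mass (tile p) / mass rect * q \<le> C * 16"
    using mass_tile_le[OF p] mass_pos C_ge_1 q_bounds by (intro mult_mono) (auto simp: field_simps)
  also have "\<dots> \<le> 16 * C^4" using C_ge_1 power_increasing[of 1 4 C] by simp
  finally show "avg (tile p) g / avg rect g \<le> 16 * C^4" unfolding ratio .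
qed

lemma normalized_moment_rect_le:
  assumes "dilation_dominated (16 * C^4) A B \<phi> \<psi>"
    and moment: "\<And>p. normalized_moment \<phi> (uniform_measure lebesgue (tile p)) g \<le> K"
  shows "normalized_moment \<psi> (uniform_measure lebesgue rect) g
      \<le> 4 * (ennreal A * K + ennreal (2 * B))"
proof -
  interpret dilation_dominated "16 * C^4" A B \<phi> \<psi> by fact
  note R = rect_mem_bounded_sets
  have "(\<integral>\<^sup>+z. ennreal (\<psi> (g z / avg rect g)) \<partial>uniform_measure lebesgue (tile p))
      \<le> ennreal A * K + ennreal (2 * B)"
    if p: "p \<in> tiles" for p
  proof -
    note D = tile_mem_bounded_sets[OF p]
    have "(\<integral>\<^sup>+z. ennreal (\<psi> (g z / avg rect g)) \<partial>uniform_measure lebesgue (tile p))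
        \<le> ennreal A * normalized_moment \<phi> (uniform_measure lebesgue (tile p)) g + ennreal (2 * B)"
    proof (rule nn_integral_dilate_le)
      show "prob_space (uniform_measure lebesgue (tile p))"
        by (rule prob_space_uniform_measure_pos[OF measure_tile_pos])
    qed (use avg_tile_comparable[OF p] bounded_sets.integrable_pos[OF D] avg_rect_pos in
        \<open>simp_all add: bounded_sets.avg_eq_expectation[OF D, symmetric]\<close>)
    also have "\<dots> \<le> ennreal A * K + ennreal (2 * B)"
      by (intro add_right_mono mult_left_mono moment) simp
    finally show ?thesis .
  qed
  then have "(\<integral>\<^sup>+z. ennreal (\<psi> (g z / avg rect g)) \<partial>uniform_measure lebesgue rect)
      \<le> ennreal 4 * (ennreal A * K + ennreal (2 * B))"
    using R
    by (intro nn_integral_uniform_measure_cover_le[where J = tiles and D = tile] finite_tiles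
        rect_subset_tiles sum_measure_tiles_le measure_tile_pos) auto
  then show ?thesis
    by (simp add: normalized_moment_def bounded_sets.avg_eq_expectation[OF R, symmetric])
qed

end

lemma (in doubling_weight) normalized_moment_torus_rect_le:
  assumes dominated: "dilation_dominated (16 * C^4) A B \<phi> \<psi>"
    and moment: "\<And>k i l j. normalized_moment \<phi>
      (uniform_measure lebesgue (dyadic_interval k i \<times> dyadic_interval l j)) g \<le> K"
    and "R \<in> torus_rects"
  shows "normalized_moment \<psi> (uniform_measure lebesgue R) g \<le> 4 * (ennreal A * K + ennreal (2 * B))"
proof -
  obtain x y r s k l where "dyadic_tiling r s k l" and R: "R = dyadic_tiling.rect x y r s"
    using \<open>R \<in> torus_rects\<close> by (rule torus_rect_tilingE)
  then interpret dyadic_tiling x y r s k l by simp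
  interpret tiled_doubling_weight C g x y r s k l ..
  show ?thesis
    unfolding R by (rule normalized_moment_rect_le[OF dominated]) (simp add: tile_def moment)
qed

subsection \<open>Translations\<close>

lemma
  fixes c :: "'a::euclidean_space"
  shows measurable_lebesgue_translation [measurable]: "(+) c \<in> lebesgue \<rightarrow>\<^sub>M lebesgue"
    and distr_lebesgue_translation: "distr lebesgue lebesgue ((+) c) = lebesgue"
proof -
  have "(\<lambda>x. c + (\<Sum>j\<in>Basis. (1 * (x \<bullet> j)) *\<^sub>R j)) = (+) c"
    by (simp add: euclidean_representation fun_eq_iff)
  then show "(+) c \<in> lebesgue \<rightarrow>\<^sub>M lebesgue" "distr lebesgue lebesgue ((+) c) = lebesgue"
    using lebesgue_affine_measurable[of "\<lambda>_. 1" c] lebesgue_affine_euclidean[of "\<lambda>_. 1" c]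
    by (simp_all add: density_1)
qed

lemma AE_lebesgue_translation:
  fixes c :: "'a::euclidean_space"
  assumes "AE z in lebesgue. P z"
  shows "AE z in lebesgue. P (c + z)"
  by (rule AE_distrD[OF measurable_lebesgue_translation[of c],
        unfolded distr_lebesgue_translation, OF assms])

lemma nn_integral_lebesgue_translation:
  fixes c :: "'a::euclidean_space"
  assumes "f \<in> borel_measurable lebesgue"
  shows "(\<integral>\<^sup>+z. f (c + z) \<partial>lebesgue) = (\<integral>\<^sup>+z. f z \<partial>lebesgue)"
  using nn_integral_distr[OF measurable_lebesgue_translation[of c], of f] assms
  by (simp add: distr_lebesgue_translation)

lemma uniform_measure_lebesgue_translation:
  fixes c :: "'a::euclidean_space"
  assumes S: "S \<in> sets lebesgue"
  shows "uniform_measure lebesgue ((+) c ` S) = distr (uniform_measure lebesgue S) lebesgue ((+) c)"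
proof (rule measure_eqI)
  fix X assume "X \<in> sets (uniform_measure lebesgue ((+) c ` S))"
  then have X [measurable]: "X \<in> sets lebesgue" by simp
  have vimage: "(+) c -` X \<in> sets lebesgue"
    using measurable_sets[OF measurable_lebesgue_translation X] by simp
  have emeasure_image: "emeasure lebesgue ((+) c ` T) = emeasure lebesgue T" for T :: "'a set"
    using emeasure_lebesgue_affine[of 1 c T] by (simp add: add.commute[of _ c])
  have "(+) c ` S \<inter> X = (+) c ` (S \<inter> (+) c -` X)" by auto
  then have "emeasure (uniform_measure lebesgue ((+) c ` S)) X
      = emeasure lebesgue (S \<inter> (+) c -` X) / emeasure lebesgue S"
    using lebesgue_sets_translation[OF S, of c] by (simp add: emeasure_image)
  also have "\<dots> = emeasure (distr (uniform_measure lebesgue S) lebesgue ((+) c)) X"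
    using S vimage by (subst emeasure_distr) auto
  finally show "emeasure (uniform_measure lebesgue ((+) c ` S)) X
      = emeasure (distr (uniform_measure lebesgue S) lebesgue ((+) c)) X" .
qed simp

lemma normalized_moment_translation:
  fixes c :: "'a::euclidean_space"
  assumes S: "S \<in> sets lebesgue"
    and [measurable]: "g \<in> borel_measurable lebesgue" "\<phi> \<in> borel_measurable borel"
  shows "normalized_moment \<phi> (uniform_measure lebesgue ((+) c ` S)) g
    = normalized_moment \<phi> (uniform_measure lebesgue S) (\<lambda>z. g (c + z))"
proof -
  have [measurable]: "(+) c \<in> uniform_measure lebesgue S \<rightarrow>\<^sub>M lebesgue"
    using measurable_lebesgue_translation[of c] by simp
  show ?thesis
    unfolding normalized_moment_def uniform_measure_lebesgue_translation[OF S]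
    by (subst nn_integral_distr) (simp_all add: integral_distr)
qed

lemma translation_Times: "(+) c ` (A \<times> B) = (+) (fst c) ` A \<times> (+) (snd c) ` B"
proof -
  have "(+) c = map_prod ((+) (fst c)) ((+) (snd c))" by (simp add: fun_eq_iff prod_eq_iff)
  then show ?thesis by (simp only: map_prod_image)
qed

lemma torus_rect_translation:
  assumes "R \<in> torus_rects"
  shows "(+) c ` R \<in> torus_rects"
proof -
  obtain a b l m where R: "R = {a..a+l} \<times> {b..b+m}" and lengths: "0 < l" "l \<le> 1" "0 < m" "m \<le> 1"
    using assms unfolding torus_rects_def by blast
  have "(+) c ` R = (+) (fst c) ` {a..a+l} \<times> (+) (snd c) ` {b..b+m}"
    unfolding R by (rule translation_Times)
  also have "\<dots> = {fst c + a..(fst c + a) + l} \<times> {snd c + b..(snd c + b) + m}"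
    by (simp add: add_ac)
  finally show ?thesis using lengths unfolding torus_rects_def by blast
qed

subsection \<open>Periodicity\<close>

definition torus_proj :: "real \<times> real \<Rightarrow> real \<times> real" where
  "torus_proj z = (frac (fst z), frac (snd z))"

abbreviation unit_cell :: "int \<Rightarrow> int \<Rightarrow> (real \<times> real) set" where
  "unit_cell i j \<equiv> dyadic_interval 0 i \<times> dyadic_interval 0 j"

abbreviation unit_square :: "(real \<times> real) set" where
  "unit_square \<equiv> {0..1} \<times> {0..1}"

lemma per_eq_torus_proj: "per f z = f (fst (torus_proj z)) (snd (torus_proj z))"
  by (simp add: per_def torus_proj_def)

lemma unit_cell_subset_unit_square: "unit_cell 0 0 \<subseteq> unit_square"
  by (auto simp: dyadic_interval_def)

lemma torus_proj_mem_unit_cell: "torus_proj z \<in> unit_cell 0 0"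
  by (simp add: torus_proj_def mem_dyadic_interval_iff)

lemma torus_proj_ident: "z \<in> unit_cell 0 0 \<Longrightarrow> torus_proj z = z"
  by (auto simp: torus_proj_def dyadic_interval_def)

lemma torus_proj_eq_diff: "torus_proj z = - (of_int \<lfloor>fst z\<rfloor>, of_int \<lfloor>snd z\<rfloor>) + z"
  by (simp add: torus_proj_def frac_def prod_eq_iff)

lemma torus_proj_add_of_int: "torus_proj ((of_int i, of_int j) + z) = torus_proj z"
  by (simp add: torus_proj_def)

lemma borel_measurable_torus_proj [measurable]: "torus_proj \<in> borel \<rightarrow>\<^sub>M borel"
proof -
  have "frac \<in> borel_measurable (borel :: real measure)"
    unfolding frac_def[abs_def] by measurable
  then show ?thesis unfolding torus_proj_def[abs_def] borel_prod[symmetric] by measurable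
qed

lemma AE_torus_proj:
  assumes "AE z in lebesgue. z \<in> unit_cell 0 0 \<longrightarrow> P z"
  shows "AE z in lebesgue. P (torus_proj z)"
proof -
  have "AE z in lebesgue. \<forall>i j. - (of_int i, of_int j) + z \<in> unit_cell 0 0
      \<longrightarrow> P (- (of_int i, of_int j) + z)"
    unfolding AE_all_countable by (intro allI AE_lebesgue_translation assms)
  then show ?thesis
  proof eventually_elim
    case (elim z)
    then show ?case using torus_proj_mem_unit_cell[of z] unfolding torus_proj_eq_diff by metis
  qed
qed

lemma measurable_torus_proj [measurable]: "torus_proj \<in> lebesgue \<rightarrow>\<^sub>M lebesgue"
proof (rule completion.measurable_completion2)
  show borel: "torus_proj \<in> lebesgue \<rightarrow>\<^sub>M lborel"
    by (rule measurable_completion) simp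
  show "null_sets lborel \<subseteq> null_sets (distr lebesgue lborel torus_proj)"
  proof
    fix N assume N: "N \<in> null_sets (lborel :: (real \<times> real) measure)"
    have "AE z in lebesgue. z \<in> unit_cell 0 0 \<longrightarrow> z \<notin> N"
      using AE_not_in[OF N] by (intro AE_completion) auto
    then have "AE z in lebesgue. torus_proj z \<notin> N" by (rule AE_torus_proj)
    moreover have "torus_proj -` N \<in> sets lebesgue"
      using measurable_sets[OF borel, of N] N by auto
    ultimately have "emeasure lebesgue (torus_proj -` N) = 0"
      using AE_iff_measurable[of "torus_proj -` N" lebesgue "\<lambda>z. torus_proj z \<notin> N"]
      by (auto simp: vimage_def)
    then show "N \<in> null_sets (distr lebesgue lborel torus_proj)"
      using N borel by (auto simp: null_sets_def emeasure_distr)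
  qed
qed

lemma nn_integral_torus_proj_unit_cell:
  assumes [measurable]: "k \<in> borel_measurable lebesgue"
  shows "(\<integral>\<^sup>+z\<in>unit_cell i j. k (torus_proj z) \<partial>lebesgue) = (\<integral>\<^sup>+z\<in>unit_cell 0 0. k z \<partial>lebesgue)"
proof -
  let ?c = "(of_int i, of_int j) :: real \<times> real"
  have [measurable]: "unit_cell i j \<in> sets lebesgue" by auto
  have "(\<integral>\<^sup>+z\<in>unit_cell i j. k (torus_proj z) \<partial>lebesgue)
      = (\<integral>\<^sup>+z. k (torus_proj (?c + z)) * indicator (unit_cell i j) (?c + z) \<partial>lebesgue)"
    by (rule nn_integral_lebesgue_translation[symmetric]) measurable
  also have "\<dots> = (\<integral>\<^sup>+z\<in>unit_cell 0 0. k z \<partial>lebesgue)"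
  proof (rule nn_integral_cong)
    fix z
    have "?c + z \<in> unit_cell i j \<longleftrightarrow> z \<in> unit_cell 0 0"
      by (cases z) (simp add: mem_dyadic_interval_iff)
    then show "k (torus_proj (?c + z)) * indicator (unit_cell i j) (?c + z)
        = k z * indicator (unit_cell 0 0) z"
      unfolding torus_proj_add_of_int by (auto simp: indicator_def torus_proj_ident)
  qed
  finally show ?thesis .
qed

lemma nn_integral_torus_proj_le:
  assumes k [measurable]: "k \<in> borel_measurable lebesgue"
    and J: "finite J" "S \<subseteq> (\<Union>p\<in>J. unit_cell (fst p) (snd p))"
  shows "(\<integral>\<^sup>+z\<in>S. k (torus_proj z) \<partial>lebesgue) \<le> of_nat (card J) * (\<integral>\<^sup>+z\<in>unit_cell 0 0. k z \<partial>lebesgue)"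
proof -
  have "(\<integral>\<^sup>+z\<in>S. k (torus_proj z) \<partial>lebesgue)
      \<le> (\<Sum>p\<in>J. \<integral>\<^sup>+z\<in>unit_cell (fst p) (snd p). k (torus_proj z) \<partial>lebesgue)"
    using J by (intro nn_set_integral_cover_le) auto
  also have "\<dots> = of_nat (card J) * (\<integral>\<^sup>+z\<in>unit_cell 0 0. k z \<partial>lebesgue)"
    by (simp add: nn_integral_torus_proj_unit_cell[OF k])
  finally show ?thesis .
qed

lemma bounded_subset_unit_cells:
  assumes "bounded S"
  obtains J where "finite J" "S \<subseteq> (\<Union>p\<in>J. unit_cell (fst p) (snd p))"
proof -
  obtain n :: nat where norm_less: "\<And>z. z \<in> S \<Longrightarrow> norm z < real n"
    using assms unfolding bounded_iff by (meson le_less_trans reals_Archimedean2)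
  have "S \<subseteq> (\<Union>p\<in>{-int n..int n} \<times> {-int n..int n}. unit_cell (fst p) (snd p))"
  proof
    fix z assume "z \<in> S"
    then have "\<bar>fst z\<bar> < real n" "\<bar>snd z\<bar> < real n"
      using norm_less[of z] norm_fst_le[of "fst z" "snd z"] norm_snd_le[of "snd z" "fst z"] by auto
    then have "\<lfloor>fst z\<rfloor> \<in> {-int n..int n}" "\<lfloor>snd z\<rfloor> \<in> {-int n..int n}"
      by (auto simp: le_floor_iff floor_le_iff)
    then show "z \<in> (\<Union>p\<in>{-int n..int n} \<times> {-int n..int n}. unit_cell (fst p) (snd p))"
      by (cases z) (simp add: mem_dyadic_interval_iff)
  qed
  then show ?thesis by (intro that) auto
qed

lemma nn_integral_torus_proj_torus_rect_le:
  assumes "k \<in> borel_measurable lebesgue" "R \<in> torus_rects"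
  shows "(\<integral>\<^sup>+z\<in>R. k (torus_proj z) \<partial>lebesgue) \<le> 4 * (\<integral>\<^sup>+z\<in>unit_cell 0 0. k z \<partial>lebesgue)"
proof -
  obtain a b l m where R: "R = {a..a+l} \<times> {b..b+m}" and lengths: "l \<le> 1" "m \<le> 1"
    using assms(2) unfolding torus_rects_def by blast
  let ?J = "{\<lfloor>a\<rfloor>, \<lfloor>a\<rfloor> + 1} \<times> {\<lfloor>b\<rfloor>, \<lfloor>b\<rfloor> + 1}"
  have floor_cases: "\<lfloor>u\<rfloor> = \<lfloor>v\<rfloor> \<or> \<lfloor>u\<rfloor> = \<lfloor>v\<rfloor> + 1" if "v \<le> u" "u \<le> v + 1" for u v :: real
    using that by linarith
  have "R \<subseteq> (\<Union>p\<in>?J. unit_cell (fst p) (snd p))"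
    using floor_cases[of a] floor_cases[of b] lengths unfolding R
    by (force simp: mem_dyadic_interval_iff)
  then show ?thesis
    using nn_integral_torus_proj_le[OF assms(1), of ?J R] by simp
qed

subsection \<open>Weights on the torus\<close>

lemma measurable_per:
  assumes "weight f"
  shows "per f \<in> borel_measurable lebesgue"
proof -
  have "(\<lambda>z. f (fst z) (snd z)) \<in> borel_measurable lebesgue" using assms by (simp add: weight_def)
  from measurable_compose[OF measurable_torus_proj this] show ?thesis
    by (simp add: per_eq_torus_proj[abs_def])
qed

lemma set_integrable_per:
  assumes weight: "weight f" and S: "bounded S" "S \<in> sets lebesgue"
  shows "set_integrable lebesgue S (per f)"
  unfolding set_integrable_def integrable_iff_bounded
proof
  note [measurable] = measurable_per[OF weight] S(2)
  show "(\<lambda>z. indicat_real S z *\<^sub>R per f z) \<in> borel_measurable lebesgue" by measurable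
  let ?k = "\<lambda>z. ennreal (norm (f (fst z) (snd z)))"
  obtain J where J: "finite J" "S \<subseteq> (\<Union>p\<in>J. unit_cell (fst p) (snd p))"
    using bounded_subset_unit_cells[OF S(1)] .
  have "(\<integral>\<^sup>+z\<in>S. ?k (torus_proj z) \<partial>lebesgue)
      \<le> of_nat (card J) * (\<integral>\<^sup>+z\<in>unit_cell 0 0. ?k z \<partial>lebesgue)"
    using weight J by (intro nn_integral_torus_proj_le) (auto simp: weight_def)
  also have "(\<integral>\<^sup>+z\<in>unit_cell 0 0. ?k z \<partial>lebesgue)
      \<le> (\<integral>\<^sup>+z. ennreal (norm (indicat_real unit_square z *\<^sub>R per f z)) \<partial>lebesgue)"
    using unit_cell_subset_unit_square
    by (intro nn_integral_mono) (auto simp: indicator_def per_eq_torus_proj torus_proj_ident)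
  also have "of_nat (card J) * \<dots> < \<infinity>"
    using weight unfolding weight_def set_integrable_def integrable_iff_bounded
    by (auto simp: ennreal_mult_less_top of_nat_less_top)
  also have "(\<integral>\<^sup>+z\<in>S. ?k (torus_proj z) \<partial>lebesgue)
      = (\<integral>\<^sup>+z. ennreal (norm (indicat_real S z *\<^sub>R per f z)) \<partial>lebesgue)"
    by (intro nn_integral_cong) (auto simp: indicator_def per_eq_torus_proj)
  finally show "(\<integral>\<^sup>+z. ennreal (norm (indicat_real S z *\<^sub>R per f z)) \<partial>lebesgue) < \<infinity>"
    by (simp add: mult_left_mono)
qed

lemma doubling_weight_per:
  assumes weight: "weight f" "doubling C (per f)"
  shows "doubling_weight C (per f)"
proof
  have "AE z in lebesgue. z \<in> unit_cell 0 0 \<longrightarrow> 0 < f (fst z) (snd z)"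
    using weight(1) unit_cell_subset_unit_square unfolding weight_def
    by (auto elim!: eventually_mono simp: per_eq_torus_proj torus_proj_ident)
  then show "AE z in lebesgue. 0 < per f z"
    unfolding per_eq_torus_proj by (rule AE_torus_proj)
qed (use weight in \<open>auto intro: measurable_per set_integrable_per\<close>)

lemma dyadic_interval_eq_translation_dyad:
  "dyadic_interval k i = (+) (of_int (i div 2^k)) ` dyad k (nat (i mod 2^k))"
proof -
  have "i = (i div 2^k) * 2^k + i mod 2^k" by (rule div_mult_mod_eq[symmetric])
  then have "real_of_int i = of_int (i div 2^k) * 2^k + of_int (i mod 2^k)"
    by (metis of_int_add of_int_mult of_int_numeral of_int_power)
  then show ?thesis
    by (simp add: dyadic_interval_def dyad_def add_divide_distrib add_ac)
qed

lemma dyad_eq_dyadic_interval: "dyad k j = dyadic_interval k (int j)"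
  by (simp add: dyad_def dyadic_interval_def)

lemma lebesgue_dyadic_rect: "D \<in> dyadic_rects \<Longrightarrow> D \<in> sets lebesgue"
  by (auto simp: dyadic_rects_def dyad_eq_dyadic_interval)

lemma measure_dyadic_rect_pos: "D \<in> dyadic_rects \<Longrightarrow> 0 < measure lebesgue D"
  by (auto simp: dyadic_rects_def dyad_eq_dyadic_interval measure_dyadic_rect)

lemma bounded_dyadic_rect: "D \<in> dyadic_rects \<Longrightarrow> bounded D"
  by (auto simp: dyadic_rects_def dyad_def intro!: bounded_Times)

lemma normalized_moment_dyadic_interval_le:
  assumes weight: "weight f" and [measurable]: "\<phi> \<in> borel_measurable borel"
  shows "normalized_moment \<phi>
      (uniform_measure lebesgue (dyadic_interval k i \<times> dyadic_interval l j)) (per f)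
    \<le> sup_moment \<phi> dyadic_rects (per f)"
proof -
  let ?D = "dyad k (nat (i mod 2^k)) \<times> dyad l (nat (j mod 2^l))"
    and ?c = "(of_int (i div 2^k), of_int (j div 2^l)) :: real \<times> real"
  have "nat (a mod 2^m) < 2^m" for a :: int and m by (simp add: nat_less_iff)
  then have D: "?D \<in> dyadic_rects" unfolding dyadic_rects_def by blast
  have "dyadic_interval k i \<times> dyadic_interval l j = (+) ?c ` ?D"
    by (simp add: translation_Times dyadic_interval_eq_translation_dyad)
  then have "normalized_moment \<phi>
      (uniform_measure lebesgue (dyadic_interval k i \<times> dyadic_interval l j)) (per f)
      = normalized_moment \<phi> (uniform_measure lebesgue ?D) (\<lambda>z. per f (?c + z))"
    using normalized_moment_translation[OF lebesgue_dyadic_rect[OF D] measurable_per[OF weight]]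
    by simp
  also have "\<dots> = normalized_moment \<phi> (uniform_measure lebesgue ?D) (per f)"
    by (simp add: per_eq_torus_proj[abs_def] torus_proj_add_of_int)
  also have "\<dots> \<le> sup_moment \<phi> dyadic_rects (per f)"
    unfolding sup_moment_def using D by (rule SUP_upper)
  finally show ?thesis .
qed

proposition sup_moment_torus_rects_le:
  assumes weight: "weight f" "doubling C (per f)"
    and dominated: "dilation_dominated (16 * C^4) A B \<phi> \<psi>"
  shows "sup_moment \<psi> torus_rects (per f)
      \<le> 4 * (ennreal A * sup_moment \<phi> dyadic_rects (per f) + ennreal (2 * B))"
proof -
  interpret doubling_weight C "per f" using weight by (rule doubling_weight_per)
  show ?thesis
    unfolding sup_moment_def[of \<psi>]
    by (intro SUP_least normalized_moment_torus_rect_le[OF dominated]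
        normalized_moment_dyadic_interval_le weight dilation_dominated.borel_measurable(1)[OF dominated])
qed

lemma (in doubling_weight) weight_on_dyadic_rects: "weight_on dyadic_rects g"
  using pos by unfold_locales
    (auto intro: lebesgue_dyadic_rect measure_dyadic_rect_pos set_integrable_bounded bounded_dyadic_rect)

subsection \<open>Averages of translated weights\<close>

lemma
  fixes P :: "(real \<times> real) \<times> (real \<times> real) \<Rightarrow> bool"
  assumes "AE u in lborel. P u"
  shows AE_AE_torus_proj_translation:
      "AE \<sigma> in lebesgue. AE z in lebesgue. P (\<sigma>, torus_proj (\<sigma> + z))"
    and AE_AE_torus_proj_translation_swap:
      "AE z in lebesgue. AE \<sigma> in lebesgue. P (\<sigma>, torus_proj (\<sigma> + z))"
proof -
  obtain N where N: "N \<in> null_sets lborel" "{u. \<not> P u} \<subseteq> N"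
    using assms unfolding eventually_ae_filter by auto
  have "AE u in lborel \<Otimes>\<^sub>M lborel. u \<notin> N"
    unfolding lborel_prod by (rule AE_not_in[OF N(1)])
  from lborel_pair.AE_pair[OF this]
  have avoid: "AE \<sigma> in lborel. AE z in lborel. (\<sigma>, torus_proj (\<sigma> + z)) \<notin> N"
  proof eventually_elim
    case (elim \<sigma>)
    then have "AE z in lebesgue. z \<in> unit_cell 0 0 \<longrightarrow> (\<sigma>, z) \<notin> N"
      by (intro AE_completion) (auto elim: eventually_mono)
    then have "AE z in lebesgue. (\<sigma>, torus_proj (\<sigma> + z)) \<notin> N"
      by (intro AE_lebesgue_translation[OF AE_torus_proj])
    then show ?case by (simp add: AE_completion_iff)
  qed
  have "(\<lambda>u. (fst u, torus_proj (fst u + snd u))) \<in> borel \<Otimes>\<^sub>M borel \<rightarrow>\<^sub>M borel \<Otimes>\<^sub>M borel"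
    by measurable
  then have vimage: "(\<lambda>u. (fst u, torus_proj (fst u + snd u))) -` (- N) \<in> sets borel"
    using N(1) measurable_sets[of _ borel borel "- N"] by (auto simp: borel_prod null_sets_def)
  have avoid_swap: "AE z in lborel. AE \<sigma> in lborel. (\<sigma>, torus_proj (\<sigma> + z)) \<notin> N"
  proof (subst lborel_pair.AE_commute[symmetric])
    show "{u \<in> space (lborel \<Otimes>\<^sub>M lborel). (fst u, torus_proj (fst u + snd u)) \<notin> N}
        \<in> sets (lborel \<Otimes>\<^sub>M lborel)"
      unfolding lborel_prod using vimage by (simp add: vimage_def)
  qed (rule avoid)
  have P: "P u" if "u \<notin> N" for u using N(2) that by auto
  show "AE \<sigma> in lebesgue. AE z in lebesgue. P (\<sigma>, torus_proj (\<sigma> + z))"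
    unfolding AE_completion_iff using avoid
    by (rule eventually_mono) (erule eventually_mono, rule P)
  show "AE z in lebesgue. AE \<sigma> in lebesgue. P (\<sigma>, torus_proj (\<sigma> + z))"
    unfolding AE_completion_iff using avoid_swap
    by (rule eventually_mono) (erule eventually_mono, rule P)
qed

lemma lebesgue_unit_square [measurable]: "unit_square \<in> sets lebesgue"
  and measure_unit_square: "measure lebesgue unit_square = 1"
  by (auto simp: measure_lebesgue_Times)

lemma prob_space_unit_square: "prob_space (uniform_measure lebesgue unit_square)"
  by (rule prob_space_uniform_measure_pos) (simp add: measure_unit_square)

lemma prob_space_torus_rect: "R \<in> torus_rects \<Longrightarrow> prob_space (uniform_measure lebesgue R)"
  by (intro prob_space_uniform_measure_pos torus_rect_measure_pos)

locale weight_family =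
  fixes C :: real and W :: "real \<Rightarrow> real \<Rightarrow> real \<Rightarrow> real \<Rightarrow> real"
  assumes joint: "joint_ok W"
    and weight: "\<And>s t. s \<in> {0..1} \<Longrightarrow> t \<in> {0..1} \<Longrightarrow> weight (W s t)"
    and doubling: "\<And>s t. s \<in> {0..1} \<Longrightarrow> t \<in> {0..1} \<Longrightarrow> doubling C (per (W s t))"
begin

abbreviation weight_at :: "real \<times> real \<Rightarrow> real \<Rightarrow> real \<Rightarrow> real" where
  "weight_at \<sigma> \<equiv> W (fst \<sigma>) (snd \<sigma>)"

lemma doubling_weight_per_W: "\<sigma> \<in> unit_square \<Longrightarrow> doubling_weight C (per (weight_at \<sigma>))"
  by (intro doubling_weight_per weight doubling) auto

lemma doubling_constant_ge_1: "1 \<le> C"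
  using doubling_weight_per_W[of "(0, 0)"] by (intro doubling_weight.doubling_constant_ge_1) auto

end

text \<open>Lebesgue measure on the product is only the completion of the product measure, so Fubini's
  theorem is applied to a Borel representative of the family.\<close>

locale weight_family_version = weight_family +
  fixes F :: "(real \<times> real) \<times> (real \<times> real) \<Rightarrow> real"
  assumes borel_F [measurable]: "F \<in> borel_measurable borel"
    and AE_eq_F: "AE u in lborel. weight_at (fst u) (fst (snd u)) (snd (snd u)) = F u"
begin

lemma borel_F_prod [measurable]: "F \<in> borel_measurable (borel \<Otimes>\<^sub>M borel)"
  unfolding borel_prod by (rule borel_F)

definition translate :: "(real \<times> real) \<times> (real \<times> real) \<Rightarrow> real" where
  "translate u = F (fst u, torus_proj (fst u + snd u))"

lemma borel_measurable_translate:
  assumes "sets M = sets lebesgue" "sets N = sets lebesgue"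
  shows "translate \<in> borel_measurable (M \<Otimes>\<^sub>M N)"
proof -
  have "(\<lambda>z. z) \<in> lebesgue \<rightarrow>\<^sub>M (borel :: (real \<times> real) measure)"
    by (intro measurable_completion) simp
  then have "(\<lambda>z. z) \<in> M \<rightarrow>\<^sub>M borel" "(\<lambda>z. z) \<in> N \<rightarrow>\<^sub>M borel"
    using assms by (simp_all cong: measurable_cong_sets)
  then have [measurable]: "fst \<in> M \<Otimes>\<^sub>M N \<rightarrow>\<^sub>M borel" "snd \<in> M \<Otimes>\<^sub>M N \<rightarrow>\<^sub>M borel"
    using measurable_compose[OF measurable_fst] measurable_compose[OF measurable_snd] by auto
  show ?thesis unfolding translate_def[abs_def] by measurable
qed

lemma AE_AE_translate_eq:
  "AE \<sigma> in lebesgue. AE z in lebesgue. per (weight_at \<sigma>) (\<sigma> + z) = translate (\<sigma>, z)"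
  "AE z in lebesgue. AE \<sigma> in lebesgue. per (weight_at \<sigma>) (\<sigma> + z) = translate (\<sigma>, z)"
  using AE_AE_torus_proj_translation[OF AE_eq_F] AE_AE_torus_proj_translation_swap[OF AE_eq_F]
  by (simp_all add: per_eq_torus_proj translate_def)

lemma nn_integral_F_finite:
  "(\<integral>\<^sup>+\<sigma>\<in>unit_square. (\<integral>\<^sup>+z\<in>unit_cell 0 0. ennreal (norm (F (\<sigma>, z))) \<partial>lborel) \<partial>lborel) < \<infinity>"
proof -
  let ?Q = "unit_square \<times> unit_cell 0 0"
  have [measurable]: "?Q \<in> sets borel" by (intro borel_Times) auto
  have "(\<integral>\<^sup>+\<sigma>\<in>unit_square. (\<integral>\<^sup>+z\<in>unit_cell 0 0. ennreal (norm (F (\<sigma>, z))) \<partial>lborel) \<partial>lborel)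
      = (\<integral>\<^sup>+\<sigma>. (\<integral>\<^sup>+z. ennreal (norm (F (\<sigma>, z))) * indicator ?Q (\<sigma>, z) \<partial>lborel) \<partial>lborel)"
    by (intro nn_integral_cong) (auto simp: indicator_def)
  also have "\<dots> = (\<integral>\<^sup>+u\<in>?Q. ennreal (norm (F u)) \<partial>(lborel \<Otimes>\<^sub>M lborel))"
    by (rule lborel.nn_integral_fst) (simp add: lborel_prod)
  also have "\<dots> = (\<integral>\<^sup>+u\<in>?Q. ennreal (norm (F u)) \<partial>lborel)"
    by (simp add: lborel_prod)
  also have "\<dots> \<le> (\<integral>\<^sup>+u. ennreal (norm (indicat_real (unit_square \<times> unit_square) u *\<^sub>R
      weight_at (fst u) (fst (snd u)) (snd (snd u)))) \<partial>lborel)"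
  proof (rule nn_integral_mono_AE)
    show "AE u in lborel. ennreal (norm (F u)) * indicator ?Q u
        \<le> ennreal (norm (indicat_real (unit_square \<times> unit_square) u *\<^sub>R
            weight_at (fst u) (fst (snd u)) (snd (snd u))))"
      using AE_eq_F by eventually_elim (use unit_cell_subset_unit_square in \<open>auto simp: indicator_def\<close>)
  qed
  also have "\<dots> < \<infinity>"
    using joint unfolding joint_ok_def set_integrable_def integrable_iff_bounded
    by (simp add: nn_integral_completion)
  finally show ?thesis .
qed

lemma nn_integral_translate_le:
  assumes R: "R \<in> torus_rects"
  shows "ennreal (measure lebesgue R) *
      (\<integral>\<^sup>+z. ennreal (norm (translate (\<sigma>, z))) \<partial>uniform_measure lebesgue R)
    \<le> 4 * (\<integral>\<^sup>+z\<in>unit_cell 0 0. ennreal (norm (F (\<sigma>, z))) \<partial>lborel)"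
proof -
  let ?k = "\<lambda>z. ennreal (norm (F (\<sigma>, z)))"
  have "(\<lambda>z. F (\<sigma>, z)) \<in> borel_measurable borel" by measurable
  then have "(\<lambda>z. F (\<sigma>, z)) \<in> borel_measurable lebesgue" by (intro measurable_completion) simp
  then have k [measurable]: "?k \<in> borel_measurable lebesgue" by measurable
  have R_lebesgue [measurable]: "R \<in> sets lebesgue" "(+) \<sigma> ` R \<in> sets lebesgue"
    using torus_rect_borel[OF R] torus_rect_borel[OF torus_rect_translation[OF R, of \<sigma>]] by auto
  have "ennreal (measure lebesgue R) * (\<integral>\<^sup>+z. ?k (torus_proj (\<sigma> + z)) \<partial>uniform_measure lebesgue R)
      = (\<integral>\<^sup>+z\<in>R. ?k (torus_proj (\<sigma> + z)) \<partial>lebesgue)"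
    by (intro nn_set_integral_eq_uniform_measure[symmetric] torus_rect_measure_pos[OF R] R_lebesgue)
      measurable
  also have "\<dots> = (\<integral>\<^sup>+z. ?k (torus_proj (\<sigma> + z)) * indicator ((+) \<sigma> ` R) (\<sigma> + z) \<partial>lebesgue)"
    by (intro nn_integral_cong) (auto simp: indicator_def)
  also have "\<dots> = (\<integral>\<^sup>+z\<in>(+) \<sigma> ` R. ?k (torus_proj z) \<partial>lebesgue)"
    by (rule nn_integral_lebesgue_translation) measurable
  also have "\<dots> \<le> 4 * (\<integral>\<^sup>+z\<in>unit_cell 0 0. ?k z \<partial>lebesgue)"
    by (intro nn_integral_torus_proj_torus_rect_le k torus_rect_translation R)
  finally show ?thesis by (simp add: translate_def nn_integral_completion)
qed

lemma AE_per_avgw_eq: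
  "AE z in lebesgue. per (avgw W) z = (\<integral>\<sigma>. translate (\<sigma>, z) \<partial>uniform_measure lebesgue unit_square)"
  using AE_AE_translate_eq(2)
proof eventually_elim
  case (elim z)
  have "(\<lambda>\<sigma>. translate (\<sigma>, z)) \<in> borel_measurable borel"
    unfolding translate_def fst_conv snd_conv by measurable
  then have meas [measurable]: "(\<lambda>\<sigma>. translate (\<sigma>, z)) \<in> borel_measurable lebesgue"
    by (intro measurable_completion) simp
  have "(\<lambda>\<sigma>. per (weight_at \<sigma>) (\<sigma> + z)) \<in> borel_measurable lebesgue"
    using elim by (intro borel_measurable_AE[OF meas]) (auto elim: eventually_mono)
  note [measurable] = this
  have "per (avgw W) z = set_lebesgue_integral lebesgue unit_square (\<lambda>\<sigma>. per (weight_at \<sigma>) (\<sigma> + z))"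
    unfolding per_def avgw_def by (simp add: frac_add_simps add.commute)
  also have "\<dots> = set_lebesgue_integral lebesgue unit_square (\<lambda>\<sigma>. translate (\<sigma>, z))"
    unfolding set_lebesgue_integral_def using elim
    by (intro integral_cong_AE) (auto elim: eventually_mono)
  also have "\<dots> = (\<integral>\<sigma>. translate (\<sigma>, z) \<partial>uniform_measure lebesgue unit_square)"
    by (simp add: integral_uniform_measure measure_unit_square)
  finally show ?case .
qed

lemma measurable_per_avgw [measurable]: "per (avgw W) \<in> borel_measurable lebesgue"
proof (rule borel_measurable_AE)
  interpret prob_space "uniform_measure lebesgue unit_square" by (rule prob_space_unit_square)
  have "(\<lambda>u. translate (snd u, fst u))
      \<in> borel_measurable (lebesgue \<Otimes>\<^sub>M uniform_measure lebesgue unit_square)"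
    by (rule measurable_compose[OF _ borel_measurable_translate[of
            "uniform_measure lebesgue unit_square" lebesgue]]) auto
  then show "(\<lambda>z. \<integral>\<sigma>. translate (\<sigma>, z) \<partial>uniform_measure lebesgue unit_square)
      \<in> borel_measurable lebesgue"
    by (intro borel_measurable_lebesgue_integral) (simp add: split_beta')
  show "AE z in lebesgue. (\<integral>\<sigma>. translate (\<sigma>, z) \<partial>uniform_measure lebesgue unit_square)
      = per (avgw W) z"
    using AE_per_avgw_eq by eventually_elim simp
qed

end

locale weight_family_rect = weight_family_version +
  fixes R :: "(real \<times> real) set"
  assumes R: "R \<in> torus_rects"
begin

abbreviation P :: "(real \<times> real) measure" where
  "P \<equiv> uniform_measure lebesgue unit_square"

abbreviation N :: "(real \<times> real) measure" where
  "N \<equiv> uniform_measure lebesgue R"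

sublocale P: prob_space P by (rule prob_space_unit_square)
sublocale N: prob_space N by (rule prob_space_torus_rect[OF R])
sublocale PN: pair_prob_space P N ..

lemma lebesgue_R [measurable]: "R \<in> sets lebesgue"
  using torus_rect_borel[OF R] by simp

lemma measurable_translate_PN [measurable]: "translate \<in> borel_measurable (P \<Otimes>\<^sub>M N)"
  by (rule borel_measurable_translate) simp_all

lemma integrable_translate: "integrable (P \<Otimes>\<^sub>M N) translate"
  unfolding integrable_iff_bounded
proof
  let ?I = "\<lambda>\<sigma>. \<integral>\<^sup>+z\<in>unit_cell 0 0. ennreal (norm (F (\<sigma>, z))) \<partial>lborel"
  have [measurable]: "(indicator (unit_cell 0 0) :: _ \<Rightarrow> ennreal) \<in> borel_measurable borel"
    by (intro borel_measurable_indicator borel_Times) auto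
  have "?I \<in> borel_measurable borel" by measurable
  then have [measurable]: "?I \<in> borel_measurable lebesgue" by (intro measurable_completion) simp
  have "ennreal (measure lebesgue R) * (\<integral>\<^sup>+u. ennreal (norm (translate u)) \<partial>(P \<Otimes>\<^sub>M N))
      = ennreal (measure lebesgue R) * (\<integral>\<^sup>+\<sigma>. \<integral>\<^sup>+z. ennreal (norm (translate (\<sigma>, z))) \<partial>N \<partial>P)"
    by (subst N.nn_integral_fst[symmetric]) simp_all
  also have "\<dots>
      = (\<integral>\<^sup>+\<sigma>. ennreal (measure lebesgue R) * (\<integral>\<^sup>+z. ennreal (norm (translate (\<sigma>, z))) \<partial>N) \<partial>P)"
    by (rule nn_integral_cmult[symmetric]) measurable
  also have "\<dots> \<le> (\<integral>\<^sup>+\<sigma>. 4 * ?I \<sigma> \<partial>P)"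
    by (intro nn_integral_mono nn_integral_translate_le R)
  also have "\<dots> = 4 * (\<integral>\<^sup>+\<sigma>. ?I \<sigma> \<partial>P)"
    by (rule nn_integral_cmult) measurable
  also have "(\<integral>\<^sup>+\<sigma>. ?I \<sigma> \<partial>P) = (\<integral>\<^sup>+\<sigma>\<in>unit_square. ?I \<sigma> \<partial>lebesgue)"
    by (subst nn_set_integral_eq_uniform_measure)
      (measurable, simp_all only: measure_unit_square, simp_all)
  also have "4 * \<dots> < \<infinity>"
    using nn_integral_F_finite by (simp add: nn_integral_completion ennreal_mult_less_top)
  finally show "(\<integral>\<^sup>+u. ennreal (norm (translate u)) \<partial>(P \<Otimes>\<^sub>M N)) < \<infinity>"
    using torus_rect_measure_pos[OF R] by (auto simp: ennreal_mult_less_top)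
qed measurable

lemma AE_translate_pos: "AE u in P \<Otimes>\<^sub>M N. 0 < translate u"
proof (rule PN.AE_pair_measure)
  show "AE \<sigma> in P. AE z in N. 0 < translate (\<sigma>, z)"
  proof (rule AE_uniform_measureI)
    show "AE \<sigma> in lebesgue. \<sigma> \<in> unit_square \<longrightarrow> (AE z in N. 0 < translate (\<sigma>, z))"
      using AE_AE_translate_eq(1)
    proof eventually_elim
      case (elim \<sigma>)
      show ?case
      proof
        assume "\<sigma> \<in> unit_square"
        then interpret doubling_weight C "per (weight_at \<sigma>)" by (rule doubling_weight_per_W)
        have "AE z in lebesgue. 0 < translate (\<sigma>, z)"
          using elim AE_lebesgue_translation[OF pos, of \<sigma>] by eventually_elim simp
        then show "AE z in N. 0 < translate (\<sigma>, z)"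
          by (intro AE_uniform_measureI) (auto elim: eventually_mono)
      qed
    qed
  qed measurable
qed measurable

lemma AE_N_avgw_eq: "AE z in N. (\<integral>\<sigma>. translate (\<sigma>, z) \<partial>P) = per (avgw W) z"
  using AE_per_avgw_eq by (intro AE_uniform_measureI lebesgue_R) (auto elim: eventually_mono)

lemma set_integrable_avgw: "set_integrable lebesgue R (per (avgw W))"
proof -
  have "integrable N (\<lambda>z. \<integral>\<sigma>. translate (\<sigma>, z) \<partial>P)"
    using PN.integrable_snd[of "\<lambda>\<sigma> z. translate (\<sigma>, z)"] integrable_translate by simp
  then have "integrable N (per (avgw W))"
    using AE_N_avgw_eq by (subst (asm) integrable_cong_AE) auto
  then show ?thesis
    using torus_rect_measure_pos[OF R] by (simp add: integrable_uniform_measure_iff)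
qed

lemma AE_avgw_pos: "AE z in lebesgue. z \<in> R \<longrightarrow> 0 < per (avgw W) z"
proof -
  have "AE z in N. AE \<sigma> in P. 0 < translate (\<sigma>, z)"
  proof (subst PN.AE_commute[symmetric])
    show "AE \<sigma> in P. AE z in N. 0 < translate (\<sigma>, z)" by (rule PN.AE_pair[OF AE_translate_pos])
    show "{u \<in> space (P \<Otimes>\<^sub>M N). 0 < translate (fst u, snd u)} \<in> sets (P \<Otimes>\<^sub>M N)"
      unfolding prod.collapse by measurable
  qed
  then have "AE z in N. 0 < per (avgw W) z"
    using PN.AE_integrable_snd[of "\<lambda>\<sigma> z. translate (\<sigma>, z)", simplified, OF integrable_translate]
      AE_N_avgw_eq
    by eventually_elim (metis P.expectation_greater)
  then show ?thesis
    using torus_rect_measure_pos[OF R] by (simp add: AE_uniform_measure_pos)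
qed

lemma AE_normalized_moment_translate_eq:
  assumes [measurable]: "\<psi> \<in> borel_measurable borel"
  shows "AE \<sigma> in P. normalized_moment \<psi> N (\<lambda>z. translate (\<sigma>, z))
    = normalized_moment \<psi> (uniform_measure lebesgue ((+) \<sigma> ` R)) (per (weight_at \<sigma>))"
proof (rule AE_uniform_measureI)
  show "AE \<sigma> in lebesgue. \<sigma> \<in> unit_square \<longrightarrow> normalized_moment \<psi> N (\<lambda>z. translate (\<sigma>, z))
      = normalized_moment \<psi> (uniform_measure lebesgue ((+) \<sigma> ` R)) (per (weight_at \<sigma>))"
    using AE_AE_translate_eq(1)
  proof (eventually_elim, intro impI)
    fix \<sigma> assume translate: "AE z in lebesgue. per (weight_at \<sigma>) (\<sigma> + z) = translate (\<sigma>, z)"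
      and "\<sigma> \<in> unit_square"
    then interpret doubling_weight C "per (weight_at \<sigma>)" by (simp only: doubling_weight_per_W)
    have shifted: "(\<lambda>z. per (weight_at \<sigma>) (\<sigma> + z)) \<in> borel_measurable lebesgue" by measurable
    have "normalized_moment \<psi> N (\<lambda>z. translate (\<sigma>, z))
        = normalized_moment \<psi> N (\<lambda>z. per (weight_at \<sigma>) (\<sigma> + z))"
    proof (rule normalized_moment_cong_AE)
      show "(\<lambda>z. per (weight_at \<sigma>) (\<sigma> + z)) \<in> borel_measurable N"
        "(\<lambda>z. translate (\<sigma>, z)) \<in> borel_measurable N"
        using shifted borel_measurable_AE[OF shifted translate] by simp_all
      show "AE z in N. translate (\<sigma>, z) = per (weight_at \<sigma>) (\<sigma> + z)"
        using translate by (intro AE_uniform_measureI) (auto elim: eventually_mono)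
    qed
    also have "\<dots> = normalized_moment \<psi> (uniform_measure lebesgue ((+) \<sigma> ` R)) (per (weight_at \<sigma>))"
      by (rule normalized_moment_translation[symmetric]) measurable
    finally show "normalized_moment \<psi> N (\<lambda>z. translate (\<sigma>, z))
      = normalized_moment \<psi> (uniform_measure lebesgue ((+) \<sigma> ` R)) (per (weight_at \<sigma>))" .
  qed
qed measurable

lemma normalized_moment_avgw_le:
  assumes [measurable]: "\<psi> \<in> borel_measurable borel"
    and convex: "convex_on {0<..} \<psi>" and nonneg: "\<And>x. 0 < x \<Longrightarrow> 0 \<le> \<psi> x"
    and moments: "\<And>\<sigma>. \<sigma> \<in> unit_square \<Longrightarrow> sup_moment \<psi> torus_rects (per (weight_at \<sigma>)) \<le> K"
  shows "normalized_moment \<psi> N (per (avgw W)) \<le> K"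
proof -
  have "AE \<sigma> in P. \<sigma> \<in> unit_square" by (intro AE_uniform_measureI) auto
  then have "AE \<sigma> in P. normalized_moment \<psi> N (\<lambda>z. translate (\<sigma>, z)) \<le> K"
    using AE_normalized_moment_translate_eq[OF assms(1)]
  proof eventually_elim
    case (elim \<sigma>)
    have "normalized_moment \<psi> (uniform_measure lebesgue ((+) \<sigma> ` R)) (per (weight_at \<sigma>)) \<le> K"
      using moments[of \<sigma>] elim torus_rect_translation[OF R, of \<sigma>]
      by (simp add: sup_moment_def SUP_le_iff)
    then show ?case using elim by simp
  qed
  then have "normalized_moment \<psi> N (\<lambda>z. \<integral>\<sigma>. translate (\<sigma>, z) \<partial>P) \<le> K"
    by (intro normalized_moment_average_le P.prob_space_axioms N.prob_space_axioms
        integrable_translate AE_translate_pos assms)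
  also have "normalized_moment \<psi> N (\<lambda>z. \<integral>\<sigma>. translate (\<sigma>, z) \<partial>P)
      = normalized_moment \<psi> N (per (avgw W))"
    by (rule normalized_moment_cong_AE[OF _ _ AE_N_avgw_eq]) simp_all
  finally show ?thesis .
qed

end

context weight_family
begin

lemma obtain_version:
  obtains F where "weight_family_version C W F"
proof -
  obtain F where "F \<in> borel_measurable lborel"
    "AE u in lborel. weight_at (fst u) (fst (snd u)) (snd (snd u)) = F u"
    using joint completion_ex_borel_measurable_real unfolding joint_ok_def by blast
  then have "weight_family_version C W F" by unfold_locales auto
  then show ?thesis by (rule that)
qed

lemma weight_on_torus_rects: "weight_on torus_rects (per (avgw W))"
proof -
  obtain F where "weight_family_version C W F" by (rule obtain_version)
  then interpret weight_family_version C W F .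
  show ?thesis
  proof
    fix R assume "R \<in> torus_rects"
    then interpret weight_family_rect C W F R by unfold_locales
    show "R \<in> sets lebesgue" "0 < measure lebesgue R"
      by (rule lebesgue_R, rule torus_rect_measure_pos[OF R])
    show "set_integrable lebesgue R (per (avgw W))" "AE z in lebesgue. z \<in> R \<longrightarrow> 0 < per (avgw W) z"
      by (rule set_integrable_avgw, rule AE_avgw_pos)
  qed measurable
qed

proposition sup_moment_avgw_le:
  assumes dominated: "dilation_dominated (16 * C^4) A B \<phi> \<psi>"
    and dyadic_moments: "\<And>s t. s \<in> {0..1} \<Longrightarrow> t \<in> {0..1}
      \<Longrightarrow> sup_moment \<phi> dyadic_rects (per (W s t)) \<le> K"
  shows "sup_moment \<psi> torus_rects (per (avgw W)) \<le> 4 * (ennreal A * K + ennreal (2 * B))"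
proof -
  interpret dilation_dominated "16 * C^4" A B \<phi> \<psi> by fact
  have "sup_moment \<psi> torus_rects (per (weight_at \<sigma>)) \<le> 4 * (ennreal A * K + ennreal (2 * B))"
    if "\<sigma> \<in> unit_square" for \<sigma>
  proof -
    have parameters: "fst \<sigma> \<in> {0..1}" "snd \<sigma> \<in> {0..1}" using that by auto
    have "sup_moment \<psi> torus_rects (per (weight_at \<sigma>))
        \<le> 4 * (ennreal A * sup_moment \<phi> dyadic_rects (per (weight_at \<sigma>)) + ennreal (2 * B))"
      by (rule sup_moment_torus_rects_le[OF weight[OF parameters] doubling[OF parameters] dominated])
    also have "\<dots> \<le> 4 * (ennreal A * K + ennreal (2 * B))"
      by (intro mult_left_mono add_right_mono dyadic_moments parameters) auto
    finally show ?thesis .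
  qed
  moreover obtain F where "weight_family_version C W F" by (rule obtain_version)
  then have "weight_family_rect C W F R" if "R \<in> torus_rects" for R
    using that by (simp add: weight_family_rect_def weight_family_rect_axioms_def)
  ultimately show ?thesis
    unfolding sup_moment_def[of \<psi> torus_rects "per (avgw W)"]
    by (intro SUP_least weight_family_rect.normalized_moment_avgw_le borel_measurable nonneg convex)
qed

end

subsection \<open>Product Muckenhoupt and reverse Hoelder conditions as moment bounds\<close>

lemma powr_le_powr_cancel_iff:
  fixes a b r :: real
  assumes "0 < r" "0 \<le> a" "0 \<le> b"
  shows "a powr r \<le> b powr r \<longleftrightarrow> a \<le> b"
  using assms by (meson linorder_not_le powr_less_mono2 powr_mono2 less_imp_le)

context weight_on
begin

lemma Ap_cond_1_iff: "Ap_cond 1 K \<R> g \<longleftrightarrow> sup_moment (\<lambda>x. max 0 (1 - K * x)) \<R> g = 0"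
proof -
  have "set_integrable lebesgue R g \<and> (AE z in lebesgue. z \<in> R \<longrightarrow> avg R g \<le> K * g z) \<longleftrightarrow>
      normalized_moment (\<lambda>x. max 0 (1 - K * x)) (uniform_measure lebesgue R) g \<le> 0"
    if R: "R \<in> \<R>" for R
    using avg_pos[OF R] set_integrable[OF R]
    by (subst normalized_moment_le_0_iff_avg[OF R]) (simp_all add: field_simps)
  then show ?thesis unfolding Ap_cond_def sup_moment_def le_zero_eq[symmetric] SUP_le_iff by simp
qed

lemma Ap_cond_infinity_iff:
  assumes "1 \<le> K"
  shows "Ap_cond \<infinity> K \<R> g \<longleftrightarrow> sup_moment (\<lambda>x. x - 1 - ln x) \<R> g \<le> ennreal (ln K)"
  unfolding Ap_cond_def sup_moment_def SUP_le_iff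
  using assms by (auto simp: normalized_moment_ln_le_iff_avg set_integrable)

lemma Ap_cond_ereal_iff:
  assumes p: "1 < p" and K_nonneg: "0 \<le> K"
  shows "Ap_cond (ereal p) K \<R> g \<longleftrightarrow>
    sup_moment (\<lambda>x. x powr - (1 / (p - 1))) \<R> g \<le> ennreal (K powr (1 / (p - 1)))"
proof -
  define r where "r = p - 1"
  have r: "0 < r" using p by (simp add: r_def)
  have "avg R g * (avg R (\<lambda>z. g z powr - (1 / r))) powr r \<le> K \<longleftrightarrow>
      avg R (\<lambda>z. g z powr - (1 / r)) \<le> K powr (1 / r) * avg R g powr - (1 / r)" if R: "R \<in> \<R>" for R
  proof -
    let ?c = "avg R g" and ?E = "avg R (\<lambda>z. g z powr - (1 / r))"
    have mean_pos: "0 < ?c" by (rule avg_pos[OF R])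
    have "?c * ?E powr r \<le> K \<longleftrightarrow> ?E powr r \<le> K / ?c"
      using mean_pos by (simp add: pos_le_divide_eq mult.commute)
    also have "K / ?c = (K powr (1 / r) * ?c powr - (1 / r)) powr r"
      using r mean_pos K_nonneg by (simp add: powr_mult powr_powr powr_minus_divide powr_divide)
    also have "?E powr r \<le> \<dots> \<longleftrightarrow> ?E \<le> K powr (1 / r) * ?c powr - (1 / r)"
      using r avg_powr_nonneg[OF R] by (intro powr_le_powr_cancel_iff) auto
    finally show ?thesis .
  qed
  moreover have "ereal p \<noteq> \<infinity>" "ereal p \<noteq> 1" using p by (simp_all add: one_ereal_def)
  ultimately show ?thesis
    unfolding Ap_cond_def sup_moment_def SUP_le_iff r_def[symmetric]
    by (auto simp: normalized_moment_powr_le_iff_avg set_integrable r_def)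
qed

lemma RH_cond_infinity_iff: "RH_cond \<infinity> K \<R> g \<longleftrightarrow> sup_moment (\<lambda>x. max 0 (x - K)) \<R> g = 0"
proof -
  have "set_integrable lebesgue R g \<and> (AE z in lebesgue. z \<in> R \<longrightarrow> g z \<le> K * avg R g) \<longleftrightarrow>
      normalized_moment (\<lambda>x. max 0 (x - K)) (uniform_measure lebesgue R) g \<le> 0" if R: "R \<in> \<R>" for R
    using avg_pos[OF R] set_integrable[OF R]
    by (subst normalized_moment_le_0_iff_avg[OF R]) (simp_all add: field_simps)
  then show ?thesis unfolding RH_cond_def sup_moment_def le_zero_eq[symmetric] SUP_le_iff by simp
qed

lemma RH_cond_ereal_iff:
  assumes p: "0 < p" and K_nonneg: "0 \<le> K"
  shows "RH_cond (ereal p) K \<R> g \<longleftrightarrow> sup_moment (\<lambda>x. x powr p) \<R> g \<le> ennreal (K powr p)"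
proof -
  have "(avg R (\<lambda>z. g z powr p)) powr (1/p) \<le> K * avg R g \<longleftrightarrow>
      avg R (\<lambda>z. g z powr p) \<le> K powr p * avg R g powr p" if R: "R \<in> \<R>" for R
  proof -
    have "(K powr p * avg R g powr p) powr (1/p) = K * avg R g"
      using p K_nonneg avg_pos[OF R] by (simp add: powr_mult powr_powr)
    then show ?thesis
      using p K_nonneg avg_powr_nonneg[OF R, of p]
        powr_le_powr_cancel_iff[of "1/p" "avg R (\<lambda>z. g z powr p)" "K powr p * avg R g powr p"]
        by simp
  qed
  then show ?thesis
    unfolding RH_cond_def sup_moment_def SUP_le_iff
    by (auto simp: normalized_moment_powr_le_iff_avg set_integrable)
qed

lemma Ap_cond_mono:
  assumes "Ap_cond p K \<R> g" "K \<le> L"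
  shows "Ap_cond p L \<R> g"
proof -
  have "AE z in lebesgue. z \<in> R \<longrightarrow> avg R g \<le> L * g z"
    if "R \<in> \<R>" "AE z in lebesgue. z \<in> R \<longrightarrow> avg R g \<le> K * g z" for R
    using that(2) pos[OF that(1)]
    by eventually_elim (meson assms(2) less_imp_le mult_right_mono order_trans)
  then show ?thesis
    using assms unfolding Ap_cond_def by (auto split: if_splits intro: order_trans)
qed

lemma RH_cond_mono:
  assumes "RH_cond p K \<R> g" "K \<le> L"
  shows "RH_cond p L \<R> g"
proof -
  have scaled: "K * avg R g \<le> L * avg R g" if "R \<in> \<R>" for R
    using avg_pos[OF that] assms(2) by (intro mult_right_mono) auto
  have "AE z in lebesgue. z \<in> R \<longrightarrow> g z \<le> L * avg R g"
    if "R \<in> \<R>" "AE z in lebesgue. z \<in> R \<longrightarrow> g z \<le> K * avg R g" for R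
    using that(2) by eventually_elim (use scaled[OF that(1)] in auto)
  with scaled show ?thesis
    using assms(1) unfolding RH_cond_def by (auto split: if_splits intro: order_trans)
qed

end

subsection \<open>Dilation bounds\<close>

lemma convex_on_max_0:
  fixes f :: "real \<Rightarrow> real"
  assumes "convex_on S f" shows "convex_on S (\<lambda>x. max 0 (f x))"
proof (rule convex_onI)
  show "convex S" using assms by (rule convex_on_imp_convex)
  fix t x y assume t: "0 < t" "t < (1::real)" and xy: "x \<in> S" "y \<in> S"
  have "f ((1 - t) *\<^sub>R x + t *\<^sub>R y) \<le> (1 - t) * f x + t * f y"
    using assms t xy by (intro convex_onD) auto
  also have "\<dots> \<le> (1 - t) * max 0 (f x) + t * max 0 (f y)"
    using t by (intro add_mono mult_left_mono) auto
  finally show "max 0 (f ((1 - t) *\<^sub>R x + t *\<^sub>R y)) \<le> (1 - t) * max 0 (f x) + t * max 0 (f y)"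
    using t by auto
qed

lemma dilation_dominated_lower_truncation:
  assumes M_ge_1: "1 \<le> M" and K_nonneg: "0 \<le> K"
  shows "dilation_dominated M 1 0 (\<lambda>x. max 0 (1 - K * x)) (\<lambda>x. max 0 (1 - M * K * x))"
proof
  show "convex_on {0<..} (\<lambda>x. max 0 (1 - M * K * x))"
    by (intro convex_on_max_0 convex_onI) (auto simp: algebra_simps)
  fix q x :: real assume q: "1 / M \<le> q" and x: "0 < x"
  have "K * x * 1 \<le> K * x * (M * q)"
    using q M_ge_1 x K_nonneg by (intro mult_left_mono) (auto simp: field_simps)
  then show "max 0 (1 - M * K * (q * x)) \<le> 1 * max 0 (1 - K * x) + 0 * (x + 1)"
    by (simp add: ac_simps)
qed simp_all

lemma dilation_dominated_upper_truncation:
  assumes M_ge_1: "1 \<le> M"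
  shows "dilation_dominated M M 0 (\<lambda>x. max 0 (x - K)) (\<lambda>x. max 0 (x - M * K))"
proof
  show "convex_on {0<..} (\<lambda>x. max 0 (x - M * K))"
    by (intro convex_on_max_0 convex_onI) (auto simp: algebra_simps)
  fix q x :: real assume "q \<le> M" and "0 < x"
  then have "q * x - M * K \<le> M * (x - K)" by (simp add: right_diff_distrib)
  also have "\<dots> \<le> M * max 0 (x - K)" using M_ge_1 by (intro mult_left_mono) auto
  finally show "max 0 (q * x - M * K) \<le> M * max 0 (x - K) + 0 * (x + 1)" using M_ge_1 by simp
qed (use M_ge_1 in simp_all)

lemma convex_on_powr_nonpos:
  assumes "a \<le> 0" shows "convex_on {0<..} (\<lambda>x::real. x powr a)"
proof (rule f''_ge0_imp_convex)
  fix x :: real assume "x \<in> {0<..}"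
  then show "((\<lambda>x. x powr a) has_real_derivative a * x powr (a - 1)) (at x)"
    "((\<lambda>x. a * x powr (a - 1)) has_real_derivative a * ((a - 1) * x powr (a - 1 - 1))) (at x)"
    by (auto intro!: derivative_eq_intros)
  show "0 \<le> a * ((a - 1) * x powr (a - 1 - 1))"
    using assms by (simp add: mult_nonpos_nonpos mult_nonpos_nonneg)
qed simp

lemma dilation_dominated_powr:
  assumes M_ge_1: "1 \<le> M" and a: "a \<le> 0 \<or> 1 \<le> a"
  shows "dilation_dominated M (M powr \<bar>a\<bar>) 0 (\<lambda>x. x powr a) (\<lambda>x. x powr a)"
proof
  show "convex_on {0<..} (\<lambda>x::real. x powr a)"
    using a by (auto intro: convex_on_powr_nonpos powr_convex)
  fix q x :: real assume q: "1 / M \<le> q" "q \<le> M" and x: "0 < x"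
  have q_pos: "0 < q" using q(1) M_ge_1 by (meson divide_pos_pos less_le_trans zero_less_one)
  have "q powr a \<le> M powr \<bar>a\<bar>"
  proof (cases "a \<le> 0")
    case True
    have "q powr a \<le> (1 / M) powr a" using q(1) M_ge_1 True by (intro powr_mono2') auto
    then show ?thesis using M_ge_1 True by (simp add: powr_divide powr_minus_divide)
  next
    case False
    then show ?thesis using q q_pos by (simp add: powr_mono2)
  qed
  then show "(q * x) powr a \<le> M powr \<bar>a\<bar> * x powr a + 0 * (x + 1)"
    using q_pos x by (simp add: powr_mult mult_right_mono)
qed (use M_ge_1 in simp_all)

lemma dilation_dominated_ln:
  assumes M_ge_1: "1 \<le> M"
  shows "dilation_dominated M 1 M (\<lambda>x. x - 1 - ln x) (\<lambda>x. x - 1 - ln x)"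
proof
  show "convex_on {0<..} (\<lambda>x::real. x - 1 - ln x)"
    by (intro convex_on_diff ln_concave convex_onI) (auto simp: algebra_simps)
  show "0 \<le> x - 1 - ln x" if "0 < x" for x :: real using ln_le_minus_one[OF that] by simp
  fix q x :: real assume q: "1 / M \<le> q" "q \<le> M" and x: "0 < x"
  have q_pos: "0 < q" using q(1) M_ge_1 by (meson divide_pos_pos less_le_trans zero_less_one)
  have "1 / q \<le> M" using q(1) q_pos M_ge_1 by (simp add: field_simps)
  then have ln_q: "- ln q \<le> M"
    using ln_le_minus_one[of "1 / q"] q_pos by (simp add: ln_div)
  have "q * x - 1 - ln (q * x) = q * x + - ln q + (- 1 - ln x)"
    using q_pos x by (simp add: ln_mult)
  also have "\<dots> \<le> M * x + M + (- 1 - ln x)"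
    using q(2) x ln_q by (intro add_mono mult_right_mono) auto
  also have "\<dots> \<le> 1 * (x - 1 - ln x) + M * (x + 1)"
    using x by (simp add: distrib_left)
  finally show "q * x - 1 - ln (q * x) \<le> 1 * (x - 1 - ln x) + M * (x + 1)" .
qed (use M_ge_1 in simp_all)

subsection \<open>Averaging theorems\<close>

context weight_family
begin

lemma weight_on_dyadic_rects_W: "s \<in> {0..1} \<Longrightarrow> t \<in> {0..1} \<Longrightarrow> weight_on dyadic_rects (per (W s t))"
  using doubling_weight_per_W[of "(s, t)"] by (intro doubling_weight.weight_on_dyadic_rects) auto

lemma comparability_constant_ge_1: "1 \<le> 16 * C^4"
proof -
  have "1 \<le> C^4" using doubling_constant_ge_1 by (rule one_le_power)
  then show ?thesis by simp
qed

interpretation avgw: weight_on torus_rects "per (avgw W)" by (rule weight_on_torus_rects)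

lemma Ap_cond_infinity_avgw:
  assumes V_ge_1: "1 \<le> V"
    and dyadic: "\<And>s t. s \<in> {0..1} \<Longrightarrow> t \<in> {0..1} \<Longrightarrow> Ap_cond \<infinity> V dyadic_rects (per (W s t))"
  shows "Ap_cond \<infinity> (exp (4 * (ln V + 32 * C^4))) torus_rects (per (avgw W))"
proof -
  have "sup_moment (\<lambda>x. x - 1 - ln x) torus_rects (per (avgw W))
      \<le> 4 * (ennreal 1 * ennreal (ln V) + ennreal (2 * (16 * C^4)))"
    using dyadic V_ge_1
    by (intro sup_moment_avgw_le[OF dilation_dominated_ln[OF comparability_constant_ge_1]])
      (simp add: weight_on.Ap_cond_infinity_iff[OF weight_on_dyadic_rects_W])
  also have "\<dots> = ennreal (4 * (ln V + 32 * C^4))"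
    using V_ge_1 by (simp add: ennreal_mult)
  finally show ?thesis
    using V_ge_1 by (simp add: avgw.Ap_cond_infinity_iff)
qed

lemma Ap_cond_ereal_avgw:
  assumes p: "1 \<le> p" and V_ge_1: "1 \<le> V"
    and dyadic: "\<And>s t. s \<in> {0..1} \<Longrightarrow> t \<in> {0..1} \<Longrightarrow> Ap_cond (ereal p) V dyadic_rects (per (W s t))"
  shows "Ap_cond (ereal p) (4 powr (p - 1) * (16 * C^4 * V)) torus_rects (per (avgw W))"
proof (cases "p = 1")
  case True
  have "sup_moment (\<lambda>x. max 0 (1 - 16 * C^4 * V * x)) torus_rects (per (avgw W))
      \<le> 4 * (ennreal 1 * 0 + ennreal (2 * 0))"
    using dyadic V_ge_1 True
    by (intro sup_moment_avgw_le[OF dilation_dominated_lower_truncation]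
        comparability_constant_ge_1)
      (simp_all add: weight_on.Ap_cond_1_iff[OF weight_on_dyadic_rects_W, symmetric]
        flip: one_ereal_def)
  then show ?thesis
    using True by (simp add: avgw.Ap_cond_1_iff flip: one_ereal_def)
next
  case False
  let ?M = "16 * C^4" and ?a = "1 / (p - 1)"
  have p: "1 < p" using p False by simp
  have "sup_moment (\<lambda>x. x powr - (1 / (p - 1))) torus_rects (per (avgw W))
      \<le> 4 * (ennreal (?M powr \<bar>- (1 / (p - 1))\<bar>) * ennreal (V powr ?a) + ennreal (2 * 0))"
    using dyadic V_ge_1 p
    by (intro sup_moment_avgw_le[OF dilation_dominated_powr[OF comparability_constant_ge_1]])
      (simp_all add: weight_on.Ap_cond_ereal_iff[OF weight_on_dyadic_rects_W, symmetric])
  also have "\<dots> = ennreal (4 * (?M powr ?a * V powr ?a))"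
    using p by (simp add: ennreal_mult)
  also have "4 * (?M powr ?a * V powr ?a) = (4 powr (p - 1) * (?M * V)) powr ?a"
    using p V_ge_1 doubling_constant_ge_1 by (simp add: powr_mult powr_powr)
  finally show ?thesis
    using p V_ge_1 by (simp add: avgw.Ap_cond_ereal_iff)
qed

lemma RH_cond_infinity_avgw:
  assumes V_ge_1: "1 \<le> V"
    and dyadic: "\<And>s t. s \<in> {0..1} \<Longrightarrow> t \<in> {0..1} \<Longrightarrow> RH_cond \<infinity> V dyadic_rects (per (W s t))"
  shows "RH_cond \<infinity> (16 * C^4 * V) torus_rects (per (avgw W))"
proof -
  have "sup_moment (\<lambda>x. max 0 (x - 16 * C^4 * V)) torus_rects (per (avgw W))
      \<le> 4 * (ennreal (16 * C^4) * 0 + ennreal (2 * 0))"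
    using dyadic V_ge_1
    by (intro sup_moment_avgw_le[OF dilation_dominated_upper_truncation]
        comparability_constant_ge_1)
      (simp_all add: weight_on.RH_cond_infinity_iff[OF weight_on_dyadic_rects_W, symmetric])
  then show ?thesis by (simp add: avgw.RH_cond_infinity_iff)
qed

lemma RH_cond_ereal_avgw:
  assumes p: "1 < p" and V_ge_1: "1 \<le> V"
    and dyadic: "\<And>s t. s \<in> {0..1} \<Longrightarrow> t \<in> {0..1} \<Longrightarrow> RH_cond (ereal p) V dyadic_rects (per (W s t))"
  shows "RH_cond (ereal p) (4 powr (1 / p) * (16 * C^4 * V)) torus_rects (per (avgw W))"
proof -
  let ?M = "16 * C^4"
  have "sup_moment (\<lambda>x. x powr p) torus_rects (per (avgw W))
      \<le> 4 * (ennreal (?M powr \<bar>p\<bar>) * ennreal (V powr p) + ennreal (2 * 0))"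
    using dyadic V_ge_1 p
    by (intro sup_moment_avgw_le[OF dilation_dominated_powr[OF comparability_constant_ge_1]])
      (simp_all add: weight_on.RH_cond_ereal_iff[OF weight_on_dyadic_rects_W, symmetric])
  also have "\<dots> = ennreal (4 * (?M powr p * V powr p))"
    using p by (simp add: ennreal_mult)
  also have "4 * (?M powr p * V powr p) = (4 powr (1 / p) * (?M * V)) powr p"
    using p V_ge_1 doubling_constant_ge_1 by (simp add: powr_mult powr_powr)
  finally show ?thesis
    using p V_ge_1 by (simp add: avgw.RH_cond_ereal_iff)
qed

end

text \<open>These characteristics are at least 1 for every weight, so \<open>max V 1\<close> loses nothing.\<close>

definition Ap_average_bound :: "ereal \<Rightarrow> real \<Rightarrow> real \<Rightarrow> real" where
  "Ap_average_bound p V C = (if p = \<infinity> then exp (4 * (ln (max V 1) + 32 * C^4))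
     else 4 powr (real_of_ereal p - 1) * (16 * C^4 * max V 1))"

definition RH_average_bound :: "ereal \<Rightarrow> real \<Rightarrow> real \<Rightarrow> real" where
  "RH_average_bound p V C = (if p = \<infinity> then 16 * C^4 * max V 1
     else 4 powr (1 / real_of_ereal p) * (16 * C^4 * max V 1))"

context weight_family
begin

theorem Ap_cond_avgw:
  assumes p: "1 \<le> p"
    and dyadic: "\<And>s t. s \<in> {0..1} \<Longrightarrow> t \<in> {0..1} \<Longrightarrow> Ap_cond p V dyadic_rects (per (W s t))"
  shows "Ap_cond p (Ap_average_bound p V C) torus_rects (per (avgw W))"
proof -
  have dyadic_max: "Ap_cond p (max V 1) dyadic_rects (per (W s t))"
    if "s \<in> {0..1}" "t \<in> {0..1}" for s t
    using weight_on.Ap_cond_mono[OF weight_on_dyadic_rects_W dyadic] that by simp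
  show ?thesis
  proof (cases p)
    case (real r)
    then show ?thesis
      using Ap_cond_ereal_avgw[of r "max V 1"] p dyadic_max
      by (simp add: Ap_average_bound_def one_ereal_def)
  next
    case PInf
    then show ?thesis
      using Ap_cond_infinity_avgw[of "max V 1"] dyadic_max by (simp add: Ap_average_bound_def)
  qed (use p in simp)
qed

theorem RH_cond_avgw:
  assumes p: "1 < p"
    and dyadic: "\<And>s t. s \<in> {0..1} \<Longrightarrow> t \<in> {0..1} \<Longrightarrow> RH_cond p V dyadic_rects (per (W s t))"
  shows "RH_cond p (RH_average_bound p V C) torus_rects (per (avgw W))"
proof -
  have dyadic_max: "RH_cond p (max V 1) dyadic_rects (per (W s t))"
    if "s \<in> {0..1}" "t \<in> {0..1}" for s t
    using weight_on.RH_cond_mono[OF weight_on_dyadic_rects_W dyadic] that by simp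
  show ?thesis
  proof (cases p)
    case (real r)
    then show ?thesis
      using RH_cond_ereal_avgw[of r "max V 1"] p dyadic_max
      by (simp add: RH_average_bound_def one_ereal_def)
  next
    case PInf
    then show ?thesis
      using RH_cond_infinity_avgw[of "max V 1"] dyadic_max by (simp add: RH_average_bound_def)
  qed (use p in simp)
qed

end

theorem mainTheorem8:
  fixes Cdbl V :: real and p :: ereal
  shows
  "(1 \<le> p \<longrightarrow> (\<exists>K::real. \<forall>W. joint_ok W \<and>
       (\<forall>s\<in>{0..1}. \<forall>t\<in>{0..1}. weight (W s t) \<and> doubling Cdbl (per (W s t))
          \<and> Ap_cond p V dyadic_rects (per (W s t)))
     \<longrightarrow> Ap_cond p K torus_rects (per (avgw W))))
 \<and> (1 < p \<longrightarrow> (\<exists>K::real. \<forall>W. joint_ok W \<and>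
       (\<forall>s\<in>{0..1}. \<forall>t\<in>{0..1}. weight (W s t) \<and> doubling Cdbl (per (W s t))
          \<and> RHd_cond p V (per (W s t)))
     \<longrightarrow> RH_cond p K torus_rects (per (avgw W))))"
proof (intro conjI impI exI allI; elim conjE)
  fix W assume p: "1 \<le> p" and W: "joint_ok W"
    "\<forall>s\<in>{0..1}. \<forall>t\<in>{0..1}. weight (W s t) \<and> doubling Cdbl (per (W s t)) \<and> Ap_cond p V dyadic_rects (per (W s t))"
  then interpret weight_family Cdbl W by unfold_locales auto
  show "Ap_cond p (Ap_average_bound p V Cdbl) torus_rects (per (avgw W))"
    using W by (intro Ap_cond_avgw p) auto
next
  fix W assume p: "1 < p" and W: "joint_ok W"
    "\<forall>s\<in>{0..1}. \<forall>t\<in>{0..1}. weight (W s t) \<and> doubling Cdbl (per (W s t)) \<and> RHd_cond p V (per (W s t))"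
  then interpret weight_family Cdbl W by unfold_locales auto
  show "RH_cond p (RH_average_bound p V Cdbl) torus_rects (per (avgw W))"
    using W unfolding RHd_cond_def by (intro RH_cond_avgw p) auto
qed

end
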